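(* Let $\alpha\in(0,1)$, let $g:\mathbb{T}^N\to\mathbb{R}$ be Lipschitz continuous, and let $H(x,p)=F(x,p)-f(x)$ on $\mathbb{T}^N\times\mathbb{R}^N$, with $F,f$ continuous, such that: 1. $F(x,\cdot)$ is convex for all $x\in\mathbb{T}^N$; $F(x,p)>F(x,0)=0$ for all $x\in\mathbb{T}^N$, $p\in\mathbb{R}^N\setminus\{0\}$; $f\ge0$, $f$ is Lipschitz continuous, and $\min_{\mathbb{T}^N}f=0$. 2. There is $c_H>0$ with $|H(x,p)-H(y,p)|\le c_H(1+|p|)|x-y|$ for all $x,y\in\mathbb{T}^N$, $p\in\mathbb{R}^N$, and $\lim_{|p|\to+\infty}\inf_{x\in\mathbb{T}^N}H(x,p)=+\infty$. 3. For every $R>0$ there exists $\nu_R>0$ such that $F(x,p)\ge\nu_R|p|$ for all $x\in\mathbb{T}^N$, $p\in B(0,R)$. Set $Z=\{x\in\mathbb{T}^N: f(x)=\min_{\mathbb{T}^N}f\}=\{f=0\}$ and $Z(\epsilon)=\{x\in\mathbb{T}^N:\ \mathrm{dist}(x,Z)<\epsilon\}$. Assume that there exist $1\le D<\frac32$ and $C>0$ such that, for all sufficiently small $\epsilon>0$ and all $x\in Z(\epsilon)$, there exist $x_0\in Z\cap\mathrm{argmin}\{g\}$ and a finite polygonal line $\gamma_\epsilon\subset Z(\epsilon)$ joining $x_0$ to $x$, formed by at most $C\epsilon^{-D}$ line segments of length $\epsilon$. Then the unique viscosity solution $u$ of $$\partial_t^\alpha u+F(x,Du)=f(x)\ \text{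 in }\mathbb{T}^N\times(0,+\infty),\qquad u(\cdot,0)=g\ \text{ in }\mathbb{T}^N$$ satisfies: for every $x\in Z$, $u(x,t)\to\min_{\mathbb{T}^N}g$ as $t\to+\infty$.
   Context: $\mathbb{T}^N=\mathbb{R}^N/\mathbb{Z}^N$ is the flat torus, $|x-y|$ for $x,y\in\mathbb{T}^N$ is the periodic (quotient) distance, $Du$ is the gradient in $x$, and $\mathrm{argmin}\{g\}=\{x: g(x)=\min_{\mathbb{T}^N}g\}$. A line segment $[x,y]$ joining $x,y\in\mathbb{T}^N$ is the projection to $\mathbb{T}^N$ of a Euclidean segment of length $|x-y|$ joining representatives of $x$ and $y$. A finite polygonal line $[x_0,\dots,x_n]$ is the union of the segments $[x_{i-1},x_i]$, $1\le i\le n$; it joins $x_0$ to $x_n$. Caputo derivative of order $\alpha\in(0,1)$ (normalizing constant taken equal to 1): a function $\phi$ on $[0,+\infty)$ is extended to $s<0$ by $\phi(s)=\phi(0)$ and, when the integral exists, $\partial_t^\alpha\phi(t)=\int_{-\infty}^t\frac{\phi(t)-\phi(s)}{|t-s|^{1+\alpha}}ds$, $t>0$. For $a<b\le t$ set $\partial_t^\alpha[a]\phi(t)=\int_{-\infty}^a\frac{\phi(t)-\phi(s)}{|t-s|^{1+\alpha}}ds$ and $\partial_t^\alpha[a,b]\phi(t)=\int_a^b\frac{\phi(t)-\phi(s)}{|t-s|^{1+\alpha}}ds$. Viscosity solutions: let $u$ be continuous on $\mathbb{T}^N\times[0,+\infty)$, extended by $u(x,s)=u(x,0)$ for $s<0$.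 $u$ is a viscosity subsolution (resp. supersolution) of $\partial_t^\alpha u+H(x,Du)=0$ in $\mathbb{T}^N\times(0,+\infty)$ if for every $(x_0,t_0)$ with $t_0>0$, every $\delta\in(0,t_0)$ and every $C^1$ function $\varphi$ such that $u-\varphi$ has a maximum (resp. minimum) at $(x_0,t_0)$ over $B_\delta(x_0)\times[t_0-\delta,t_0+\delta]$, one has $$\partial_t^\alpha[t_0-\delta]u(x_0,\cdot)(t_0)+\partial_t^\alpha[t_0-\delta,t_0]\varphi(x_0,\cdot)(t_0)+H(x_0,D\varphi(x_0,t_0))\le0\quad(\text{resp. }\ge0).$$ A viscosity solution is both a sub- and a supersolution. The initial condition is understood pointwise. *)

theory Defs
  imports "HOL-Analysis.Analysis"
begin

text \<open>
  A point of the flat torus is given by any of its representatives in \<^typ>\<open>real ^ 'n\<close>; a function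
  on the torus is a function on \<^typ>\<open>real ^ 'n\<close> that is constant on the classes of \<open>torus_eq\<close>, and
  a subset of the torus is the (saturated) set of all representatives of its points.
\<close>

definition torus_eq :: "real ^ 'n \<Rightarrow> real ^ 'n \<Rightarrow> bool" where
  "torus_eq x y \<longleftrightarrow> (\<forall>i. x $ i - y $ i \<in> \<int>)"

definition periodic :: "(real ^ 'n \<Rightarrow> 'b) \<Rightarrow> bool" where
  "periodic h \<longleftrightarrow> (\<forall>x y. torus_eq x y \<longrightarrow> h x = h y)"

definition torus_dist :: "real ^ 'n \<Rightarrow> real ^ 'n \<Rightarrow> real" where
  "torus_dist x y = Inf {dist x' y' | x' y'. torus_eq x' x \<and> torus_eq y' y}"

definition torus_lipschitz :: "(real ^ 'n \<Rightarrow> real) \<Rightarrow> bool" where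
  "torus_lipschitz h \<longleftrightarrow> (\<exists>L\<ge>0. \<forall>x y. \<bar>h x - h y\<bar> \<le> L * torus_dist x y)"

text \<open>For continuous periodic \<open>h\<close> the infimum is attained, by compactness of the torus.\<close>

definition torus_min :: "(real ^ 'n \<Rightarrow> real) \<Rightarrow> real" where
  "torus_min h = (INF x. h x)"

definition argmin_set :: "(real ^ 'n \<Rightarrow> real) \<Rightarrow> (real ^ 'n) set" where
  "argmin_set h = {x. h x = torus_min h}"

definition torus_nbhd :: "(real ^ 'n) set \<Rightarrow> real \<Rightarrow> (real ^ 'n) set" where
  "torus_nbhd Z \<epsilon> = {x. (INF z\<in>Z. torus_dist x z) < \<epsilon>}"

text \<open>
  A segment joining two given points need not be unique on the torus, hence relations instead of
  functions.
\<close>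

definition is_torus_segment :: "real ^ 'n \<Rightarrow> real ^ 'n \<Rightarrow> (real ^ 'n) set \<Rightarrow> bool" where
  "is_torus_segment x y S \<longleftrightarrow>
     (\<exists>x' y'. torus_eq x' x \<and> torus_eq y' y \<and> dist x' y' = torus_dist x y \<and>
        S = {z. \<exists>w\<in>closed_segment x' y'. torus_eq z w})"

definition is_polygonal_line :: "nat \<Rightarrow> (nat \<Rightarrow> real ^ 'n) \<Rightarrow> (real ^ 'n) set \<Rightarrow> bool" where
  "is_polygonal_line n xs \<gamma> \<longleftrightarrow>
     (\<exists>S. (\<forall>i\<in>{1..n}. is_torus_segment (xs (i - 1)) (xs i) (S i)) \<and> \<gamma> = (\<Union>i\<in>{1..n}. S i))"

definition extend_past :: "(real \<Rightarrow> real) \<Rightarrow> real \<Rightarrow> real" where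
  "extend_past \<phi> s = (if s < 0 then \<phi> 0 else \<phi> s)"

text \<open>
  The two pieces of the Caputo derivative of order \<open>\<alpha>\<close> at \<open>t\<close>, over \<open>(-\<infinity>, a]\<close> and over \<open>[a, b]\<close>
  respectively, for \<open>a < b \<le> t\<close>.
\<close>

definition caputo_tail :: "real \<Rightarrow> real \<Rightarrow> (real \<Rightarrow> real) \<Rightarrow> real \<Rightarrow> real" where
  "caputo_tail \<alpha> a \<phi> t =
     (LBINT s:{..a}. (extend_past \<phi> t - extend_past \<phi> s) / \<bar>t - s\<bar> powr (1 + \<alpha>))"

definition caputo_between :: "real \<Rightarrow> real \<Rightarrow> real \<Rightarrow> (real \<Rightarrow> real) \<Rightarrow> real \<Rightarrow> real" where
  "caputo_between \<alpha> a b \<phi> t =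
     (LBINT s:{a..b}. (extend_past \<phi> t - extend_past \<phi> s) / \<bar>t - s\<bar> powr (1 + \<alpha>))"

definition grad :: "('a::real_inner \<Rightarrow> real) \<Rightarrow> 'a \<Rightarrow> 'a" where
  "grad h x = (THE p. GDERIV h x :> p)"

definition C1_on :: "('a::real_inner \<Rightarrow> real) \<Rightarrow> 'a set \<Rightarrow> bool" where
  "C1_on h S \<longleftrightarrow> (\<exists>G. (\<forall>z\<in>S. GDERIV h z :> G z) \<and> continuous_on S G)"

definition test_function :: "(real ^ 'n \<Rightarrow> real \<Rightarrow> real) \<Rightarrow> bool" where
  "test_function \<phi> \<longleftrightarrow>
     (\<forall>t>0. periodic (\<lambda>x. \<phi> x t)) \<and> C1_on (\<lambda>(x, t). \<phi> x t) (UNIV \<times> {0<..})"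

definition torus_cylinder :: "real ^ 'n \<Rightarrow> real \<Rightarrow> real \<Rightarrow> ((real ^ 'n) \<times> real) set" where
  "torus_cylinder x\<^sub>0 t\<^sub>0 \<delta> = {y. torus_dist y x\<^sub>0 < \<delta>} \<times> {t\<^sub>0 - \<delta>..t\<^sub>0 + \<delta>}"

definition viscosity_subsolution ::
    "real \<Rightarrow> (real ^ 'n \<Rightarrow> real ^ 'n \<Rightarrow> real) \<Rightarrow> (real ^ 'n \<Rightarrow> real \<Rightarrow> real) \<Rightarrow> bool" where
  "viscosity_subsolution \<alpha> H u \<longleftrightarrow>
     (\<forall>x\<^sub>0 t\<^sub>0 \<delta> \<phi>. 0 < t\<^sub>0 \<and> 0 < \<delta> \<and> \<delta> < t\<^sub>0 \<and> test_function \<phi> \<and>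
        (\<forall>(y, s)\<in>torus_cylinder x\<^sub>0 t\<^sub>0 \<delta>. u y s - \<phi> y s \<le> u x\<^sub>0 t\<^sub>0 - \<phi> x\<^sub>0 t\<^sub>0) \<longrightarrow>
        caputo_tail \<alpha> (t\<^sub>0 - \<delta>) (u x\<^sub>0) t\<^sub>0 + caputo_between \<alpha> (t\<^sub>0 - \<delta>) t\<^sub>0 (\<phi> x\<^sub>0) t\<^sub>0
          + H x\<^sub>0 (grad (\<lambda>x. \<phi> x t\<^sub>0) x\<^sub>0) \<le> 0)"

definition viscosity_supersolution ::
    "real \<Rightarrow> (real ^ 'n \<Rightarrow> real ^ 'n \<Rightarrow> real) \<Rightarrow> (real ^ 'n \<Rightarrow> real \<Rightarrow> real) \<Rightarrow> bool" where
  "viscosity_supersolution \<alpha> H u \<longleftrightarrow>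
     (\<forall>x\<^sub>0 t\<^sub>0 \<delta> \<phi>. 0 < t\<^sub>0 \<and> 0 < \<delta> \<and> \<delta> < t\<^sub>0 \<and> test_function \<phi> \<and>
        (\<forall>(y, s)\<in>torus_cylinder x\<^sub>0 t\<^sub>0 \<delta>. u x\<^sub>0 t\<^sub>0 - \<phi> x\<^sub>0 t\<^sub>0 \<le> u y s - \<phi> y s) \<longrightarrow>
        0 \<le> caputo_tail \<alpha> (t\<^sub>0 - \<delta>) (u x\<^sub>0) t\<^sub>0 + caputo_between \<alpha> (t\<^sub>0 - \<delta>) t\<^sub>0 (\<phi> x\<^sub>0) t\<^sub>0
          + H x\<^sub>0 (grad (\<lambda>x. \<phi> x t\<^sub>0) x\<^sub>0))"

text \<open>Only the values \<open>u x t\<close> with \<open>t \<ge> 0\<close> matter below.\<close>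

definition viscosity_solution ::
    "real \<Rightarrow> (real ^ 'n \<Rightarrow> real ^ 'n \<Rightarrow> real) \<Rightarrow> (real ^ 'n \<Rightarrow> real \<Rightarrow> real) \<Rightarrow> bool" where
  "viscosity_solution \<alpha> H u \<longleftrightarrow>
     (\<forall>t\<ge>0. periodic (\<lambda>x. u x t)) \<and>
     continuous_on (UNIV \<times> {0..}) (\<lambda>(x, t). u x t) \<and>
     viscosity_subsolution \<alpha> H u \<and> viscosity_supersolution \<alpha> H u"

end

theory Submission
  imports Defs
begin

text \<open>
  By convexity, \<open>F x p \<ge> \<nu> * norm p\<close> for all \<open>p\<close>, so \<open>u\<close> is a subsolution of a fractional eikonal
  equation with right-hand side \<open>f\<close>. Comparison with paraboloids centred at \<open>z \<in> Z\<close> shows that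
  \<open>u z t \<le> g z\<close> on \<open>Z\<close> and that \<open>u\<close> is bounded; comparison with the constant \<open>min g\<close> gives the lower
  bound. Penalising time on a large scale \<open>R\<close> makes the Caputo derivative of order \<open>R powr -\<alpha>\<close>, so
  that asymptotically in time \<open>u\<close> obeys the stationary equation. Since \<open>f\<close> is \<open>L\<close>-Lipschitz, comparison
  with the cone of slope \<open>(f x + L * r) / \<nu>\<close> at distance \<open>r\<close> from its vertex \<open>x\<close> yields
  \<open>limsup u y \<le> limsup u x + (f x * r + L * r\<^sup>2 / 2) / \<nu>\<close> with \<open>r = norm (y - x)\<close>. Each of the at most
  \<open>C * \<epsilon> powr -D\<close> steps of the chain costs \<open>3 * L * \<epsilon>\<^sup>2 / (2 * \<nu>)\<close>, and the total tends to \<open>0\<close> with \<open>\<epsilon>\<close>.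
\<close>

section \<open>Integrals of the Caputo kernel\<close>

text \<open>Bridge from the gauge integral, in which integrals of powers are available, to the
  Bochner integral, in which the Caputo pieces are defined: a nonnegative gauge-integrable function
  is absolutely integrable.\<close>

lemma has_bochner_integral_nonneg_has_integral:
  fixes h :: "real \<Rightarrow> real"
  assumes h: "(h has_integral I) A" "h \<in> borel_measurable borel" "A \<in> sets borel"
    and nonneg: "\<And>x. x \<in> A \<Longrightarrow> 0 \<le> h x"
  shows "has_bochner_integral lborel (\<lambda>x. indicator A x * h x) I"
proof -
  have "set_integrable lebesgue A h"
    by (intro nonnegative_absolutely_integrable_1) (use h nonneg in auto)
  then have "set_integrable lborel A h"
    using h unfolding set_integrable_def by (subst (asm) integrable_completion) auto
  then have "set_lebesgue_integral lborel A h = I"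
    using h(1) by (simp add: set_borel_integral_eq_integral(2) integral_unique)
  then show ?thesis
    using \<open>set_integrable lborel A h\<close>
    by (simp add: has_bochner_integral_iff set_integrable_def set_lebesgue_integral_def)
qed

text \<open>Substitute \<open>x = t - s\<close>. The value is of order
  \<open>R powr -\<alpha>\<close>, which makes the distant past negligible for large
  \<open>R\<close>.\<close>

lemma has_bochner_integral_kernel_tail:
  fixes \<alpha> R t :: real
  assumes "0 < \<alpha>" "0 < R"
  shows "has_bochner_integral lborel (\<lambda>s. indicator {..t - R} s * \<bar>t - s\<bar> powr (- (1 + \<alpha>))) (R powr - \<alpha> / \<alpha>)"
proof -
  have "((\<lambda>x. x powr (- (1 + \<alpha>))) has_integral R powr - \<alpha> / \<alpha>) {R..}"
    using has_integral_powr_to_inf[of "- (1 + \<alpha>)" R] assms by simp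
  then have "has_bochner_integral lborel (\<lambda>x. indicator {R..} x * x powr (- (1 + \<alpha>))) (R powr - \<alpha> / \<alpha>)"
    by (intro has_bochner_integral_nonneg_has_integral) auto
  then have "has_bochner_integral lborel (\<lambda>x. indicator {R..} (t + -1 * x) * (t + -1 * x) powr (- (1 + \<alpha>))) (R powr - \<alpha> / \<alpha>)"
    by (subst (asm) lborel_has_bochner_integral_real_affine_iff[where c = "-1" and t = t]) auto
  then show ?thesis
    by (rule has_bochner_integral_cong[THEN iffD1, rotated -1])
      (use assms in \<open>auto simp: indicator_def\<close>)
qed

text \<open>The exponent is \<open>-\<alpha>\<close> instead of \<open>-(1 + \<alpha>)\<close>
  because an increment bounded by a multiple of \<open>t - s\<close> cancels one power of the
  kernel.\<close>

lemma has_bochner_integral_kernel_near: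
  fixes \<alpha> R t :: real
  assumes "\<alpha> < 1" "0 \<le> R"
  shows "has_bochner_integral lborel (\<lambda>s. indicator {t - R..t} s * \<bar>t - s\<bar> powr (- \<alpha>)) (R powr (1 - \<alpha>) / (1 - \<alpha>))"
proof -
  have "((\<lambda>x. x powr (- \<alpha>)) has_integral R powr (1 - \<alpha>) / (1 - \<alpha>)) {0..R}"
    using has_integral_powr_from_0[of "- \<alpha>" R] assms by simp
  then have "has_bochner_integral lborel (\<lambda>x. indicator {0..R} x * x powr (- \<alpha>)) (R powr (1 - \<alpha>) / (1 - \<alpha>))"
    by (intro has_bochner_integral_nonneg_has_integral) auto
  then have "has_bochner_integral lborel (\<lambda>x. indicator {0..R} (t + -1 * x) * (t + -1 * x) powr (- \<alpha>)) (R powr (1 - \<alpha>) / (1 - \<alpha>))"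
    by (subst (asm) lborel_has_bochner_integral_real_affine_iff[where c = "-1" and t = t]) auto
  then show ?thesis
    by (rule has_bochner_integral_cong[THEN iffD1, rotated -1])
      (auto simp: indicator_def)
qed

section \<open>Lower bounds for the two pieces of the Caputo derivative\<close>

lemma extend_past_max: "extend_past \<phi> s = \<phi> (max s 0)"
  by (simp add: extend_past_def max_def)

lemma continuous_extend_past:
  assumes "continuous_on {0..} \<phi>"
  shows "continuous_on UNIV (extend_past \<phi>)"
proof -
  have "extend_past \<phi> = (\<lambda>s. \<phi> (max s 0))"
    by (simp add: fun_eq_iff extend_past_max)
  moreover have "continuous_on UNIV (\<lambda>s. \<phi> (max s 0))"
    by (rule continuous_on_compose2[OF assms]) (auto intro!: continuous_intros)
  ultimately show ?thesis by simp
qed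

text \<open>The extension is constant before time \<open>0\<close>, so its values on a left
  half-line are those on a compact interval.\<close>

lemma bounded_extend_past:
  assumes "continuous_on {0..} \<phi>"
  obtains B where "0 \<le> B" "\<And>s. s \<le> t \<Longrightarrow> \<bar>extend_past \<phi> s\<bar> \<le> B"
proof -
  have "compact (extend_past \<phi> ` {0..max t 0})"
    by (intro compact_continuous_image continuous_on_subset[OF continuous_extend_past[OF assms]]) auto
  then obtain B where B: "\<And>s. s \<in> {0..max t 0} \<Longrightarrow> \<bar>extend_past \<phi> s\<bar> \<le> B"
    using compact_imp_bounded bounded_iff by (metis (no_types, lifting) image_eqI real_norm_def)
  have "\<bar>extend_past \<phi> s\<bar> \<le> B" if "s \<le> t" for s
    using B[of "max s 0"] that by (simp add: extend_past_max)
  moreover have "0 \<le> B" using B[of 0] by force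
  ultimately show ?thesis by (rule that[rotated])
qed

text \<open>The gap \<delta> cuts off the singularity and the extension is bounded up to time
  \<open>t\<close>, so a multiple of the kernel dominates. Without integrability the Bochner
  integral would take the default value \<open>0\<close> and could not be compared with a
  minorant.\<close>

lemma caputo_tail_integrable:
  assumes \<alpha>: "0 < \<alpha>" and \<delta>: "0 < \<delta>" and \<phi>: "continuous_on {0..} \<phi>"
  shows "integrable lborel (\<lambda>s. indicator {..t - \<delta>} s *
           ((extend_past \<phi> t - extend_past \<phi> s) / \<bar>t - s\<bar> powr (1 + \<alpha>)))"
proof -
  obtain B where B: "0 \<le> B" "\<And>s. s \<le> t \<Longrightarrow> \<bar>extend_past \<phi> s\<bar> \<le> B"
    using bounded_extend_past[OF \<phi>, of t] by blast
  have meas: "extend_past \<phi> \<in> borel_measurable borel"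
    by (intro borel_measurable_continuous_onI continuous_extend_past \<phi>)
  have int: "integrable lborel (\<lambda>s. 2 * B * (indicator {..t - \<delta>} s * \<bar>t - s\<bar> powr (- (1 + \<alpha>))))"
    using has_bochner_integral_kernel_tail[OF \<alpha> \<delta>] by (auto simp: has_bochner_integral_iff)
  show ?thesis
  proof (rule Bochner_Integration.integrable_bound[OF int])
    show "(\<lambda>s. indicator {..t - \<delta>} s *
           ((extend_past \<phi> t - extend_past \<phi> s) / \<bar>t - s\<bar> powr (1 + \<alpha>))) \<in> borel_measurable lborel"
      using meas by measurable
    show "AE s in lborel. norm (indicator {..t - \<delta>} s *
           ((extend_past \<phi> t - extend_past \<phi> s) / \<bar>t - s\<bar> powr (1 + \<alpha>)))
         \<le> norm (2 * B * (indicator {..t - \<delta>} s * \<bar>t - s\<bar> powr (- (1 + \<alpha>))))"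
    proof (rule AE_I2)
      fix s
      have "\<bar>extend_past \<phi> t - extend_past \<phi> s\<bar> * \<bar>t - s\<bar> powr (- (1 + \<alpha>)) \<le> 2 * B * \<bar>t - s\<bar> powr (- (1 + \<alpha>))"
        if "s \<le> t - \<delta>"
        using B(2)[of t] B(2)[of s] that \<delta> by (intro mult_right_mono) auto
      then show "norm (indicator {..t - \<delta>} s *
           ((extend_past \<phi> t - extend_past \<phi> s) / \<bar>t - s\<bar> powr (1 + \<alpha>)))
         \<le> norm (2 * B * (indicator {..t - \<delta>} s * \<bar>t - s\<bar> powr (- (1 + \<alpha>))))"
        using B(1) unfolding powr_minus by (auto simp: indicator_def divide_inverse abs_mult)
    qed
  qed
qed

lemma divide_kernel:
  fixes r :: real
  assumes "0 < r"
  shows "- (c * r) / r powr (1 + \<alpha>) = - c * r powr (- \<alpha>)"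
  using assms by (simp add: powr_add powr_minus field_simps)

text \<open>Integrate a pointwise minorant: slope \<open>c\<close> on the window of length
  \<open>R\<close>, the constant \<open>B\<close> before it. The near part of the minorant is spread
  over all of \<open>{t - R..t}\<close>, which only lowers the bound. A negative \<open>B\<close>
  makes the contribution of the far past positive.\<close>

lemma caputo_tail_ge:
  assumes \<alpha>: "0 < \<alpha>" "\<alpha> < 1" and \<delta>: "0 < \<delta>" "\<delta> \<le> R" and \<phi>: "continuous_on {0..} \<phi>"
    and c: "0 \<le> c"
    and near: "\<And>s. t - R \<le> s \<Longrightarrow> s \<le> t - \<delta> \<Longrightarrow> - (c * (t - s)) \<le> extend_past \<phi> t - extend_past \<phi> s"
    and far: "\<And>s. s < t - R \<Longrightarrow> - B \<le> extend_past \<phi> t - extend_past \<phi> s"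
  shows "- c * (R powr (1 - \<alpha>) / (1 - \<alpha>)) - B * (R powr - \<alpha> / \<alpha>) \<le> caputo_tail \<alpha> (t - \<delta>) \<phi> t"
proof -
  let ?l = "\<lambda>s. - c * (indicator {t - R..t} s * \<bar>t - s\<bar> powr (- \<alpha>))
              - B * (indicator {..t - R} s * \<bar>t - s\<bar> powr (- (1 + \<alpha>)))"
  let ?k = "\<lambda>s. indicator {..t - \<delta>} s * ((extend_past \<phi> t - extend_past \<phi> s) / \<bar>t - s\<bar> powr (1 + \<alpha>))"
  have l: "has_bochner_integral lborel ?l
       (- c * (R powr (1 - \<alpha>) / (1 - \<alpha>)) - B * (R powr - \<alpha> / \<alpha>))"
    using \<alpha> \<delta> by (intro has_bochner_integral_diff has_bochner_integral_mult_right
        has_bochner_integral_kernel_near has_bochner_integral_kernel_tail) auto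
  \<comment> \<open>At \<open>t - R\<close> both indicators of the minorant equal \<open>1\<close>;
    this single point is a null set.\<close>
  have le: "?l s \<le> ?k s" if "s \<noteq> t - R" for s
  proof (cases "s \<le> t - \<delta>")
    case True
    then have pos: "0 < t - s" using \<delta> by simp
    show ?thesis
    proof (cases "s < t - R")
      case True
      have "- B / (t - s) powr (1 + \<alpha>) \<le> (extend_past \<phi> t - extend_past \<phi> s) / (t - s) powr (1 + \<alpha>)"
        by (intro divide_right_mono far True) auto
      moreover have "- B / (t - s) powr (1 + \<alpha>) = - B * (t - s) powr (- (1 + \<alpha>))"
        unfolding powr_minus by (simp add: divide_inverse)
      ultimately show ?thesis using True \<open>s \<le> t - \<delta>\<close> pos by simp
    next
      case False
      have "- (c * (t - s)) / (t - s) powr (1 + \<alpha>) \<le> (extend_past \<phi> t - extend_past \<phi> s) / (t - s) powr (1 + \<alpha>)"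
        using False True by (intro divide_right_mono near) auto
      then show ?thesis using True False that pos divide_kernel[OF pos] by simp
    qed
  next
    case False
    then show ?thesis using c \<delta> that by (simp add: indicator_def)
  qed
  have "AE s in lborel. s \<noteq> t - R"
    by (rule AE_lborel_singleton)
  then have "AE s in lborel. ?l s \<le> ?k s"
    by eventually_elim (rule le)
  then have "integral\<^sup>L lborel ?l \<le> integral\<^sup>L lborel ?k"
    using l caputo_tail_integrable[OF \<alpha>(1) \<delta>(1) \<phi>]
    by (intro integral_mono_AE) (auto simp: has_bochner_integral_iff)
  then show ?thesis
    using l unfolding caputo_tail_def set_lebesgue_integral_def
    by (simp add: has_bochner_integral_iff)
qed

lemma caputo_between_ge:
  assumes \<alpha>: "\<alpha> < 1" and \<delta>: "0 < \<delta>" "\<delta> < t" and c: "0 \<le> c"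
    and near: "\<And>s. t - \<delta> \<le> s \<Longrightarrow> s \<le> t \<Longrightarrow> - (c * (t - s)) \<le> \<psi> t - \<psi> s"
  shows "- c * (\<delta> powr (1 - \<alpha>) / (1 - \<alpha>)) \<le> caputo_between \<alpha> (t - \<delta>) t \<psi> t"
proof -
  let ?l = "\<lambda>s. - c * (indicator {t - \<delta>..t} s * \<bar>t - s\<bar> powr (- \<alpha>))"
  let ?k = "\<lambda>s. indicator {t - \<delta>..t} s * ((extend_past \<psi> t - extend_past \<psi> s) / \<bar>t - s\<bar> powr (1 + \<alpha>))"
  have l: "has_bochner_integral lborel ?l (- c * (\<delta> powr (1 - \<alpha>) / (1 - \<alpha>)))"
    using \<alpha> \<delta> by (intro has_bochner_integral_mult_right has_bochner_integral_kernel_near) auto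
  have le: "?l s \<le> ?k s" for s
  proof (cases "t - \<delta> \<le> s \<and> s < t")
    case True
    then have pos: "0 < t - s" by simp
    have "- (c * (t - s)) / (t - s) powr (1 + \<alpha>) \<le> (\<psi> t - \<psi> s) / (t - s) powr (1 + \<alpha>)"
      using True by (intro divide_right_mono near) auto
    then show ?thesis using True \<delta> divide_kernel[OF pos] by (simp add: extend_past_def)
  qed (auto simp: indicator_def)
  \<comment> \<open>The one-sided bound on \<psi> does not make the integrand integrable. If it is
    not, the integral is \<open>0\<close> by convention, and the minorant has a nonpositive
    integral.\<close>
  have "integral\<^sup>L lborel ?l \<le> integral\<^sup>L lborel ?k"
  proof (cases "integrable lborel ?k")
    case True
    then show ?thesis using l le by (intro integral_mono) (auto simp: has_bochner_integral_iff)
  next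
    case False
    have "integral\<^sup>L lborel ?l \<le> 0"
      using l c \<alpha> \<delta> by (simp add: has_bochner_integral_iff)
    then show ?thesis by (subst not_integrable_integral_eq[OF False])
  qed
  then show ?thesis
    using l unfolding caputo_between_def set_lebesgue_integral_def
    by (simp add: has_bochner_integral_iff)
qed

section \<open>Representatives of points of the torus\<close>

lemma torus_eq_refl [simp]: "torus_eq x x"
  by (simp add: torus_eq_def)

lemma torus_dist_bdd_below: "bdd_below {dist x' y' | x' y'. torus_eq x' x \<and> torus_eq y' y}"
  by (rule bdd_belowI[of _ 0]) auto

lemma torus_dist_le_dist: "torus_dist x y \<le> dist x y"
  unfolding torus_dist_def by (rule cInf_lower[OF _ torus_dist_bdd_below]) (auto intro: torus_eq_refl)

lemma torus_dist_nonneg: "0 \<le> torus_dist x y"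
  unfolding torus_dist_def by (rule cInf_greatest) (auto intro: torus_eq_refl)

text \<open>Translate a nearly optimal pair of representatives so that the second one becomes
  \<open>x\<close> itself. In this way a ball of the torus is seen as a Euclidean ball around a
  fixed representative.\<close>

lemma torus_dist_less_obtains:
  assumes "torus_dist y x < \<delta>"
  obtains y' where "torus_eq y' y" "dist y' x < \<delta>"
proof -
  have "{dist x' y' | x' y'. torus_eq x' y \<and> torus_eq y' x} \<noteq> {}"
    by (auto intro: torus_eq_refl)
  with assms obtain a b where ab: "torus_eq a y" "torus_eq b x" "dist a b < \<delta>"
    unfolding torus_dist_def using cInf_less_iff[OF _ torus_dist_bdd_below] by blast
  have "a $ i - b $ i + x $ i - y $ i \<in> \<int>" for i
    using ab(1,2) Ints_diff[of "a $ i - y $ i" "b $ i - x $ i"] unfolding torus_eq_def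
    by (simp add: algebra_simps)
  then have "torus_eq (a - b + x) y"
    unfolding torus_eq_def by simp
  moreover have "dist (a - b + x) x < \<delta>"
    using ab(3) by (simp add: dist_norm)
  ultimately show ?thesis by (rule that)
qed

lemma torus_eq_cbox:
  fixes y :: "real ^ 'n"
  obtains y' where "torus_eq y' y" "y' \<in> cbox 0 1"
proof
  show "torus_eq (\<chi> i. frac (y $ i)) y"
    by (simp add: torus_eq_def frac_def)
  show "(\<chi> i. frac (y $ i)) \<in> cbox 0 1"
    by (simp add: mem_box_cart frac_lt_1 less_imp_le)
qed

text \<open>The constant is raised by one to make it strictly positive, as the later slopes
  require.\<close>

lemma torus_lipschitzE:
  assumes "torus_lipschitz h"
  obtains L where "0 < L" "\<And>x y. \<bar>h x - h y\<bar> \<le> L * torus_dist x y" "\<And>x y. \<bar>h x - h y\<bar> \<le> L * dist x y"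
proof -
  obtain L where L: "L \<ge> 0" "\<And>x y. \<bar>h x - h y\<bar> \<le> L * torus_dist x y"
    using assms unfolding torus_lipschitz_def by blast
  have 1: "\<bar>h x - h y\<bar> \<le> (L + 1) * torus_dist x y" for x y
    using L(2)[of x y] torus_dist_nonneg[of x y] by (simp add: algebra_simps)
  have 2: "\<bar>h x - h y\<bar> \<le> (L + 1) * dist x y" for x y
    using 1[of x y] mult_left_mono[OF torus_dist_le_dist, of "L + 1"] L(1) by (smt (verit))
  show ?thesis using that[of "L + 1"] L(1) 1 2 by simp
qed

section \<open>Periodic test functions\<close>

lemma grad_eqI:
  assumes "GDERIV h x :> p"
  shows "grad h x = p"
  unfolding grad_def
proof (rule the_equality[where P = "\<lambda>p. GDERIV h x :> p", OF assms])
  fix q assume "GDERIV h x :> q"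
  with assms have "(\<lambda>v. v \<bullet> q) = (\<lambda>v. v \<bullet> p)"
    unfolding gderiv_def by (rule has_derivative_unique[rotated])
  then have "(q - p) \<bullet> q = (q - p) \<bullet> p" by meson
  then have "(q - p) \<bullet> (q - p) = 0" by (simp add: inner_diff_right)
  then show "q = p" by simp
qed

lemma sin_minus_self_bound:
  fixes z :: real
  shows "\<bar>sin z - z\<bar> \<le> \<bar>z\<bar> ^ 3 / 6"
proof -
  have sum: "(\<Sum>m<3. sin_coeff m * z ^ m) = z"
    by (simp add: eval_nat_numeral sin_coeff_def)
  have fact: "inverse (fact 3) = (1 / 6 :: real)"
    by (simp add: fact_numeral)
  show ?thesis using Maclaurin_sin_bound[of z 3] unfolding sum fact by simp
qed

text \<open>With \<open>w = \<bar>z\<bar> / 2\<close> one has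
  \<open>1 - cos z = 2 * (sin w)\<^sup>2\<close>, and the cubic error of the sine gives
  \<open>sin w \<ge> 5 / 6 * w\<close>.\<close>

lemma one_minus_cos_ge:
  fixes z :: real
  assumes "\<bar>z\<bar> \<le> 1"
  shows "z\<^sup>2 / 4 \<le> 1 - cos z"
proof -
  define w where "w = \<bar>z\<bar> / 2"
  have w: "0 \<le> w" "w \<le> 1 / 2" using assms by (auto simp: w_def)
  have "\<bar>sin w - w\<bar> \<le> w ^ 3 / 6" using sin_minus_self_bound[of w] w by simp
  moreover have "w ^ 3 \<le> w * 1"
    unfolding power3_eq_cube mult.assoc using w by (intro mult_left_mono) (auto simp: mult_le_one)
  ultimately have "5 / 6 * w \<le> sin w" by linarith
  then have "(5 / 6 * w)\<^sup>2 \<le> (sin w)\<^sup>2" using w by (intro power_mono) auto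
  then have "w\<^sup>2 \<le> 2 * (sin w)\<^sup>2"
    using zero_le_power2[of "sin w"] unfolding power_mult_distrib power_divide
    by (simp only: power2_eq_square)
  moreover have "cos z = 1 - 2 * (sin w)\<^sup>2"
    using cos_double_sin[of w] cos_abs_real[of z] by (simp add: w_def)
  ultimately show ?thesis by (simp add: w_def power_divide)
qed

text \<open>
  Test functions must be periodic, so the paraboloid \<open>p \<bullet> h + q * (norm h)\<^sup>2\<close> is replaced by a
  trigonometric polynomial with the same value and gradient at \<open>0\<close> that dominates it near \<open>0\<close>.
\<close>

definition trig_quadratic :: "real ^ 'n \<Rightarrow> real \<Rightarrow> real ^ 'n \<Rightarrow> real" where
  "trig_quadratic p B h =
     (\<Sum>i\<in>UNIV. p $ i * sin (2 * pi * h $ i) / (2 * pi) + B * (1 - cos (2 * pi * h $ i)))"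

definition trig_quadratic_grad :: "real ^ 'n \<Rightarrow> real \<Rightarrow> real ^ 'n \<Rightarrow> real ^ 'n" where
  "trig_quadratic_grad p B h =
     (\<chi> i. p $ i * cos (2 * pi * h $ i) + B * (2 * pi) * sin (2 * pi * h $ i))"

lemma trig_quadratic_0 [simp]: "trig_quadratic p B 0 = 0"
  by (simp add: trig_quadratic_def)

lemma trig_quadratic_grad_0 [simp]: "trig_quadratic_grad p B 0 = p"
  by (simp add: trig_quadratic_grad_def vec_eq_iff)

lemma periodic_trig_quadratic: "periodic (\<lambda>x. trig_quadratic p B (x - c))"
  unfolding periodic_def
proof (intro allI impI)
  fix x y :: "real ^ 'a" assume "torus_eq x y"
  then have k: "x $ i - y $ i \<in> \<int>" for i by (simp add: torus_eq_def)
  have k2: "sin (2 * pi * (x $ i - y $ i)) = 0 \<and> cos (2 * pi * (x $ i - y $ i)) = 1" for i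
  proof -
    from k[of i] obtain n where "x $ i - y $ i = of_int n" by (auto elim: Ints_cases)
    then show ?thesis by (simp add: sin_int_2pin cos_int_2pin)
  qed
  have "sin (2 * pi * (x $ i - c $ i)) = sin (2 * pi * (y $ i - c $ i) + 2 * pi * (x $ i - y $ i))"
    "cos (2 * pi * (x $ i - c $ i)) = cos (2 * pi * (y $ i - c $ i) + 2 * pi * (x $ i - y $ i))" for i
    by (simp_all add: algebra_simps)
  then have "sin (2 * pi * (x $ i - c $ i)) = sin (2 * pi * (y $ i - c $ i))"
    "cos (2 * pi * (x $ i - c $ i)) = cos (2 * pi * (y $ i - c $ i))" for i
    using k2[of i] by (simp_all add: sin_add cos_add)
  then show "trig_quadratic p B (x - c) = trig_quadratic p B (y - c)"
    by (simp add: trig_quadratic_def)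
qed

text \<open>Work coordinatewise with \<open>z = 2 * pi * h $ i\<close>. Replacing the linear term by
  a sine costs at most \<open>norm p * z\<^sup>2\<close>, the quadratic term is at most
  \<open>\<bar>q\<bar> * z\<^sup>2\<close>, and \<open>B * (1 - cos z)\<close>, which is at least
  \<open>B * z\<^sup>2 / 4\<close>, absorbs both. The radius \<open>1 / 8\<close> ensures
  \<open>\<bar>z\<bar> \<le> 1\<close>.\<close>

lemma trig_quadratic_ge:
  fixes p h :: "real ^ 'n"
  assumes "norm h \<le> 1 / 8" "4 * (norm p + \<bar>q\<bar>) \<le> B"
  shows "p \<bullet> h + q * (norm h)\<^sup>2 \<le> trig_quadratic p B h"
proof -
  have "p $ i * h $ i + q * (h $ i)\<^sup>2 \<le>
      p $ i * sin (2 * pi * h $ i) / (2 * pi) + B * (1 - cos (2 * pi * h $ i))" for i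
  proof -
    define z where "z = 2 * pi * h $ i"
    have hz: "h $ i = z / (2 * pi)" by (simp add: z_def)
    have "\<bar>h $ i\<bar> \<le> 1 / 8" using component_le_norm_cart[of h i] assms by linarith
    then have "\<bar>z\<bar> \<le> 2 * pi * (1 / 8)" by (simp add: z_def abs_mult)
    then have z: "\<bar>z\<bar> \<le> 1" using pi_less_4 by linarith
    have "\<bar>z\<bar> ^ 3 \<le> z\<^sup>2"
      using mult_left_mono[OF z, of "z\<^sup>2"] by (simp add: power3_eq_cube power2_eq_square abs_mult)
    then have sz: "\<bar>sin z - z\<bar> \<le> z\<^sup>2" using sin_minus_self_bound[of z] abs_ge_zero[of "sin z - z"] by linarith
    have pi1: "1 \<le> 2 * pi" using pi_ge_two by simp
    have "\<bar>p $ i * (sin z - z) / (2 * pi)\<bar> = \<bar>p $ i\<bar> * \<bar>sin z - z\<bar> / (2 * pi)"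
      by (simp add: abs_mult)
    also have "\<dots> \<le> \<bar>p $ i\<bar> * \<bar>sin z - z\<bar>"
      using divide_left_mono[OF pi1, of "\<bar>p $ i\<bar> * \<bar>sin z - z\<bar>"] by simp
    also have "\<dots> \<le> norm p * z\<^sup>2"
      using sz component_le_norm_cart[of p i] by (intro mult_mono) auto
    finally have a: "\<bar>p $ i * (sin z - z) / (2 * pi)\<bar> \<le> norm p * z\<^sup>2" .
    have "(h $ i)\<^sup>2 \<le> z\<^sup>2"
    proof -
      have "\<bar>h $ i\<bar> \<le> \<bar>z\<bar>"
        using mult_right_mono[OF pi1, of "\<bar>h $ i\<bar>"] by (simp add: z_def abs_mult)
      then show ?thesis using power_mono[of "\<bar>h $ i\<bar>" "\<bar>z\<bar>" 2] by simp
    qed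
    then have b: "q * (h $ i)\<^sup>2 \<le> \<bar>q\<bar> * z\<^sup>2"
      by (meson abs_ge_self abs_ge_zero mult_mono order_trans zero_le_power2)
    have "4 * (norm p + \<bar>q\<bar>) * (z\<^sup>2 / 4) \<le> B * (1 - cos z)"
      using assms(2) one_minus_cos_ge[OF z] by (intro mult_mono) (auto intro: order_trans[OF _ assms(2)])
    then have c: "(norm p + \<bar>q\<bar>) * z\<^sup>2 \<le> B * (1 - cos z)" by linarith
    have "p $ i * h $ i = p $ i * sin z / (2 * pi) - p $ i * (sin z - z) / (2 * pi)"
      by (simp add: hz algebra_simps diff_divide_distrib)
    then show ?thesis using abs_le_D2[OF a] b c unfolding z_def[symmetric] distrib_right by linarith
  qed
  then have "(\<Sum>i\<in>UNIV. p $ i * h $ i + q * (h $ i)\<^sup>2) \<le> trig_quadratic p B h"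
    unfolding trig_quadratic_def by (intro sum_mono)
  moreover have "(\<Sum>i\<in>UNIV. p $ i * h $ i + q * (h $ i)\<^sup>2) = p \<bullet> h + q * (norm h)\<^sup>2"
    unfolding power2_norm_eq_inner by (simp add: sum.distrib inner_vec_def sum_distrib_left power2_eq_square)
  ultimately show ?thesis by simp
qed

lemma trig_quadratic_has_derivative:
  fixes p c x :: "real ^ 'n"
  shows "((\<lambda>x. trig_quadratic p B (x - c)) has_derivative (\<lambda>v. v \<bullet> trig_quadratic_grad p B (x - c))) (at x)"
proof -
  have "((\<lambda>x. p $ i * sin (2 * pi * (x - c) $ i) / (2 * pi) + B * (1 - cos (2 * pi * (x - c) $ i)))
      has_derivative (\<lambda>v. trig_quadratic_grad p B (x - c) $ i * v $ i)) (at x)" for i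
  proof (rule has_derivative_compose[where f = "\<lambda>x. (x - c) $ i" and f' = "\<lambda>v. v $ i"])
    show "((\<lambda>x. (x - c) $ i) has_derivative (\<lambda>v. v $ i)) (at x)"
      by (intro bounded_linear.has_derivative[OF bounded_linear_vec_nth])
         (auto intro!: derivative_eq_intros)
    show "((\<lambda>r. p $ i * sin (2 * pi * r) / (2 * pi) + B * (1 - cos (2 * pi * r)))
        has_derivative (*) (trig_quadratic_grad p B (x - c) $ i)) (at ((x - c) $ i))"
      unfolding has_field_derivative_def[symmetric] trig_quadratic_grad_def
      by (auto intro!: derivative_eq_intros)
  qed
  then have "((\<lambda>x. trig_quadratic p B (x - c)) has_derivative
      (\<lambda>v. \<Sum>i\<in>UNIV. trig_quadratic_grad p B (x - c) $ i * v $ i)) (at x)"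
    unfolding trig_quadratic_def by (rule has_derivative_sum)
  then show ?thesis by (simp add: inner_vec_def mult.commute)
qed

lemma trig_quadratic_test_function:
  fixes p c :: "real ^ 'n"
  assumes \<psi>: "\<And>t. (\<psi> has_real_derivative \<psi>' t) (at t)" "continuous_on UNIV \<psi>'"
  shows "test_function (\<lambda>x t. trig_quadratic p B (x - c) + \<psi> t)"
    and "grad (\<lambda>x. trig_quadratic p B (x - c) + \<psi> t) x = trig_quadratic_grad p B (x - c)"
proof -
  let ?G = "\<lambda>z. (trig_quadratic_grad p B (fst z - c), \<psi>' (snd z))"
  have "GDERIV (\<lambda>(x, t). trig_quadratic p B (x - c) + \<psi> t) z :> ?G z" for z
  proof -
    have "((\<lambda>z. trig_quadratic p B (fst z - c)) has_derivative
       (\<lambda>v. fst v \<bullet> trig_quadratic_grad p B (fst z - c))) (at z)"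
      by (rule has_derivative_compose[OF _ trig_quadratic_has_derivative])
         (auto intro!: derivative_eq_intros)
    moreover have "((\<lambda>z. \<psi> (snd z)) has_derivative (\<lambda>v. snd v * \<psi>' (snd z))) (at z)"
      by (rule has_derivative_compose[OF _ \<psi>(1)[unfolded has_field_derivative_def], THEN has_derivative_eq_rhs])
         (auto intro!: derivative_eq_intros simp: mult.commute)
    ultimately have "((\<lambda>z. trig_quadratic p B (fst z - c) + \<psi> (snd z)) has_derivative
       (\<lambda>v. v \<bullet> ?G z)) (at z)"
      by (auto intro!: derivative_eq_intros simp: inner_prod_def)
    then show ?thesis by (simp add: gderiv_def case_prod_beta')
  qed
  moreover have "continuous_on (UNIV \<times> {0<..}) ?G"
    unfolding trig_quadratic_grad_def
    by (intro continuous_intros continuous_on_compose2[OF \<psi>(2)]) auto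
  ultimately have "C1_on (\<lambda>(x, t). trig_quadratic p B (x - c) + \<psi> t) (UNIV \<times> {0<..})"
    unfolding C1_on_def by (intro exI[of _ ?G]) simp
  moreover have "periodic (\<lambda>x. trig_quadratic p B (x - c) + \<psi> t)" for t
    using periodic_trig_quadratic[of p B c] unfolding periodic_def by simp
  ultimately show "test_function (\<lambda>x t. trig_quadratic p B (x - c) + \<psi> t)"
    unfolding test_function_def by blast
  show "grad (\<lambda>x. trig_quadratic p B (x - c) + \<psi> t) x = trig_quadratic_grad p B (x - c)"
    by (rule grad_eqI) (auto simp: gderiv_def intro!: derivative_eq_intros trig_quadratic_has_derivative)
qed

section \<open>Testing with paraboloids and with functions of time\<close>

lemma caputo_between_add_const:
  "caputo_between \<alpha> a b (\<lambda>s. k + \<psi> s) t = caputo_between \<alpha> a b \<psi> t"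
proof -
  have "extend_past (\<lambda>s. k + \<psi> s) t - extend_past (\<lambda>s. k + \<psi> s) s
      = extend_past \<psi> t - extend_past \<psi> s" for s t
    by (simp add: extend_past_def)
  then show ?thesis by (simp add: caputo_between_def)
qed

text \<open>Makes the non-periodic paraboloid admissible. Around \<open>y\<^sub>0\<close> its
  increment is \<open>p \<bullet> h + q * (norm h)\<^sup>2\<close> with
  \<open>p = 2 * q * (y\<^sub>0 - x)\<close>, so the trigonometric polynomial centred at
  \<open>y\<^sub>0\<close> lies above it nearby and has the same gradient there. Periodicity moves
  each point of the cylinder to a representative close to \<open>y\<^sub>0\<close>.\<close>

lemma subsolution_quadratic_test:
  fixes x y\<^sub>0 :: "real ^ 'n"
  assumes sub: "viscosity_subsolution \<alpha> H u"
    and per: "\<And>t. 0 \<le> t \<Longrightarrow> periodic (\<lambda>x. u x t)"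
    and \<psi>: "\<And>t. (\<psi> has_real_derivative \<psi>' t) (at t)" "continuous_on UNIV \<psi>'"
    and \<delta>: "0 < \<delta>" "\<delta> < t\<^sub>0" "\<delta> \<le> 1 / 8"
    and max: "\<And>y s. t\<^sub>0 - \<delta> \<le> s \<Longrightarrow> s \<le> t\<^sub>0 + \<delta> \<Longrightarrow>
      u y s - q * (norm (y - x))\<^sup>2 - \<psi> s \<le> u y\<^sub>0 t\<^sub>0 - q * (norm (y\<^sub>0 - x))\<^sup>2 - \<psi> t\<^sub>0"
  shows "caputo_tail \<alpha> (t\<^sub>0 - \<delta>) (u y\<^sub>0) t\<^sub>0 + caputo_between \<alpha> (t\<^sub>0 - \<delta>) t\<^sub>0 \<psi> t\<^sub>0
           + H y\<^sub>0 ((2 * q) *\<^sub>R (y\<^sub>0 - x)) \<le> 0"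
proof -
  define p where "p = (2 * q) *\<^sub>R (y\<^sub>0 - x)"
  define B where "B = 4 * (norm p + \<bar>q\<bar>)"
  let ?\<phi> = "\<lambda>y t. trig_quadratic p B (y - y\<^sub>0) + \<psi> t"
  have "u y s - ?\<phi> y s \<le> u y\<^sub>0 t\<^sub>0 - ?\<phi> y\<^sub>0 t\<^sub>0"
    if ys: "(y, s) \<in> torus_cylinder y\<^sub>0 t\<^sub>0 \<delta>" for y s
  proof -
    have s: "t\<^sub>0 - \<delta> \<le> s" "s \<le> t\<^sub>0 + \<delta>" "0 \<le> s" and "torus_dist y y\<^sub>0 < \<delta>"
      using ys \<delta> by (auto simp: torus_cylinder_def)
    then obtain y' where y': "torus_eq y' y" "dist y' y\<^sub>0 < \<delta>"
      using torus_dist_less_obtains by blast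
    have "u y s - ?\<phi> y s = u y' s - ?\<phi> y' s"
      using per[OF s(3), unfolded periodic_def, rule_format, OF y'(1)]
        periodic_trig_quadratic[of p B y\<^sub>0, unfolded periodic_def, rule_format, OF y'(1)] by simp
    also have "\<dots> \<le> u y\<^sub>0 t\<^sub>0 - ?\<phi> y\<^sub>0 t\<^sub>0"
    proof -
      have "p \<bullet> (y' - y\<^sub>0) + q * (norm (y' - y\<^sub>0))\<^sup>2 \<le> trig_quadratic p B (y' - y\<^sub>0)"
        using y'(2) \<delta>(3) by (intro trig_quadratic_ge) (auto simp: B_def dist_norm)
      moreover have "p \<bullet> (y' - y\<^sub>0) + q * (norm (y' - y\<^sub>0))\<^sup>2
          = q * (norm (y' - x))\<^sup>2 - q * (norm (y\<^sub>0 - x))\<^sup>2"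
        by (simp add: p_def power2_norm_eq_inner inner_diff_left inner_diff_right
            inner_commute algebra_simps)
      ultimately show ?thesis using max[OF s(1,2), of y'] by simp
    qed
    finally show ?thesis .
  qed
  then have "\<forall>(y, s)\<in>torus_cylinder y\<^sub>0 t\<^sub>0 \<delta>. u y s - ?\<phi> y s \<le> u y\<^sub>0 t\<^sub>0 - ?\<phi> y\<^sub>0 t\<^sub>0"
    by blast
  then have "caputo_tail \<alpha> (t\<^sub>0 - \<delta>) (u y\<^sub>0) t\<^sub>0 + caputo_between \<alpha> (t\<^sub>0 - \<delta>) t\<^sub>0 (?\<phi> y\<^sub>0) t\<^sub>0
           + H y\<^sub>0 (grad (\<lambda>x. ?\<phi> x t\<^sub>0) y\<^sub>0) \<le> 0"
    using sub[unfolded viscosity_subsolution_def, THEN spec[of _ y\<^sub>0], THEN spec[of _ t\<^sub>0],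
        THEN spec[of _ \<delta>], THEN spec[of _ ?\<phi>]] \<delta> trig_quadratic_test_function(1)[OF \<psi>, of p B y\<^sub>0]
    by linarith
  then show ?thesis
    by (simp add: trig_quadratic_test_function(2)[OF \<psi>] p_def caputo_between_add_const)
qed

text \<open>With zero coefficients the trigonometric polynomial vanishes, so a function of time
  alone is an admissible test function with zero gradient.\<close>

lemma supersolution_time_test:
  fixes y\<^sub>0 :: "real ^ 'n"
  assumes super: "viscosity_supersolution \<alpha> H u"
    and \<psi>: "\<And>t. (\<psi> has_real_derivative \<psi>' t) (at t)" "continuous_on UNIV \<psi>'"
    and \<delta>: "0 < \<delta>" "\<delta> < t\<^sub>0"
    and min: "\<And>y s. t\<^sub>0 - \<delta> \<le> s \<Longrightarrow> s \<le> t\<^sub>0 + \<delta> \<Longrightarrow> u y\<^sub>0 t\<^sub>0 - \<psi> t\<^sub>0 \<le> u y s - \<psi> s"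
  shows "0 \<le> caputo_tail \<alpha> (t\<^sub>0 - \<delta>) (u y\<^sub>0) t\<^sub>0 + caputo_between \<alpha> (t\<^sub>0 - \<delta>) t\<^sub>0 \<psi> t\<^sub>0 + H y\<^sub>0 0"
proof -
  have const: "trig_quadratic 0 0 y = 0" "trig_quadratic_grad 0 0 y = 0" for y :: "real ^ 'n"
    by (simp_all add: trig_quadratic_def trig_quadratic_grad_def vec_eq_iff)
  have "test_function (\<lambda>x :: real ^ 'n. \<psi>)" "grad (\<lambda>x. \<psi> t\<^sub>0) y\<^sub>0 = 0"
    using trig_quadratic_test_function[OF \<psi>, where p = "0 :: real ^ 'n" and B = 0] by (simp_all add: const)
  moreover have "\<forall>(y, s)\<in>torus_cylinder y\<^sub>0 t\<^sub>0 \<delta>. u y\<^sub>0 t\<^sub>0 - \<psi> t\<^sub>0 \<le> u y s - \<psi> s"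
    using min by (auto simp: torus_cylinder_def)
  ultimately show ?thesis
    using super[unfolded viscosity_supersolution_def, THEN spec[of _ y\<^sub>0], THEN spec[of _ t\<^sub>0],
        THEN spec[of _ \<delta>], THEN spec[of _ "\<lambda>_. \<psi>"]] \<delta> by simp
qed

section \<open>Comparison on finite time intervals\<close>

text \<open>Here \<open>\<phi> - \<psi>\<close> is maximal at \<open>t\<close> among times in
  \<open>{0..t}\<close>, so \<open>\<phi> t\<close> exceeds every value up to
  \<open>t - \<delta>\<close> by at least the increment \<open>c\<close> of \<psi>. This yields a
  strictly positive tail, and the remaining piece is nonnegative by monotonicity of \<psi>.\<close>

lemma caputo_increasing_pos:
  assumes \<alpha>: "0 < \<alpha>" "\<alpha> < 1" and \<delta>: "0 < \<delta>" "\<delta> < t" and \<phi>: "continuous_on {0..} \<phi>"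
    and mono: "strict_mono_on {0..} \<psi>"
    and le: "\<And>s. 0 \<le> s \<Longrightarrow> s \<le> t \<Longrightarrow> \<psi> t - \<psi> s \<le> \<phi> t - \<phi> s"
  shows "0 < caputo_tail \<alpha> (t - \<delta>) \<phi> t + caputo_between \<alpha> (t - \<delta>) t \<psi> t"
proof -
  define c where "c = \<psi> t - \<psi> (t - \<delta>)"
  have "0 < c"
    unfolding c_def using strict_mono_onD[OF mono, of "t - \<delta>" t] \<delta> by simp
  have le_\<psi>: "\<psi> s \<le> \<psi> s'" if "0 \<le> s" "s \<le> s'" for s s'
    using strict_mono_onD[OF mono, of s s'] that by (cases "s = s'") auto
  have past: "c \<le> extend_past \<phi> t - extend_past \<phi> s" if "s \<le> t - \<delta>" for s
    using le[of "max s 0"] le_\<psi>[of "max s 0" "t - \<delta>"] \<delta> that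
    by (simp add: extend_past_max c_def)
  have past': "0 \<le> extend_past \<phi> t - extend_past \<phi> s" if "s \<le> t - \<delta>" for s
    using past[OF that] \<open>0 < c\<close> by simp
  \<comment> \<open>The tail bound is taken with window length \<open>R = \<delta>\<close>, slope
    \<open>0\<close> and \<open>B = - c\<close>.\<close>
  have "- 0 * (\<delta> powr (1 - \<alpha>) / (1 - \<alpha>)) - (- c) * (\<delta> powr - \<alpha> / \<alpha>) \<le> caputo_tail \<alpha> (t - \<delta>) \<phi> t"
    by (rule caputo_tail_ge[OF \<alpha> \<delta>(1) order_refl \<phi> order_refl]) (use past past' in \<open>simp_all del: diff_ge_0_iff_ge\<close>)
  moreover have "0 < c * (\<delta> powr - \<alpha> / \<alpha>)"
    using \<open>0 < c\<close> \<alpha> \<delta> by simp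
  moreover have "- 0 * (\<delta> powr (1 - \<alpha>) / (1 - \<alpha>)) \<le> caputo_between \<alpha> (t - \<delta>) t \<psi> t"
    using \<delta> le_\<psi> by (intro caputo_between_ge \<alpha> \<delta>) auto
  ultimately show ?thesis by simp
qed

lemma caputo_tail_uminus: "caputo_tail \<alpha> a (\<lambda>s. - \<phi> s) t = - caputo_tail \<alpha> a \<phi> t"
proof -
  have "(extend_past (\<lambda>s. - \<phi> s) t - extend_past (\<lambda>s. - \<phi> s) s) / k
      = - 1 * ((extend_past \<phi> t - extend_past \<phi> s) / k)" for s k
    by (simp add: extend_past_max minus_divide_left)
  then show ?thesis
    unfolding caputo_tail_def by (simp only: set_integral_mult_right)
qed

lemma caputo_between_uminus: "caputo_between \<alpha> a b (\<lambda>s. - \<phi> s) t = - caputo_between \<alpha> a b \<phi> t"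
proof -
  have "(extend_past (\<lambda>s. - \<phi> s) t - extend_past (\<lambda>s. - \<phi> s) s) / k
      = - 1 * ((extend_past \<phi> t - extend_past \<phi> s) / k)" for s k
    by (simp add: extend_past_max minus_divide_left)
  then show ?thesis
    unfolding caputo_between_def by (simp only: set_integral_mult_right)
qed

text \<open>A high power of \<open>t / T\<close>, scaled by \<eta>: it is small at \<open>T\<close>
  but as large as desired at \<open>2 * T\<close>. Penalising with it keeps an extremum over
  \<open>{0..2 * T}\<close> away from the final time at cost \<eta> at time
  \<open>T\<close>.\<close>

lemma power_barrier:
  fixes \<eta> T b :: real
  assumes "0 < \<eta>" "0 < T"
  obtains \<psi> \<psi>' where "\<And>t. (\<psi> has_real_derivative \<psi>' t) (at t)" "continuous_on UNIV \<psi>'"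
    "strict_mono_on {0..} \<psi>" "\<psi> 0 = 0" "\<psi> T = \<eta>" "b < \<psi> (2 * T)"
proof -
  obtain n where n: "b / \<eta> < 2 ^ n" using real_arch_pow[of 2] by auto
  let ?\<psi> = "\<lambda>t. \<eta> * (t / T) ^ Suc n" and ?\<psi>' = "\<lambda>t. \<eta> * (real (Suc n) * (t / T) ^ n * (1 / T))"
  have "b < \<eta> * 2 ^ n" using n assms by (simp add: field_simps)
  also have "\<dots> \<le> ?\<psi> (2 * T)" using assms by simp
  finally have "b < ?\<psi> (2 * T)" .
  moreover have "(?\<psi> has_real_derivative ?\<psi>' t) (at t)" for t
  proof -
    have "((\<lambda>t. t / T) has_real_derivative 1 / T) (at t)"
      using assms by (auto intro!: derivative_eq_intros)
    from DERIV_cmult[OF DERIV_power_Suc[OF this], of \<eta> n] show ?thesis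
      by (simp del: power_Suc add: mult_ac)
  qed
  moreover have "continuous_on UNIV ?\<psi>'"
    by (intro continuous_intros) (use assms in auto)
  moreover have "strict_mono_on {0..} ?\<psi>"
    using assms by (intro strict_mono_onI mult_strict_left_mono power_strict_mono divide_strict_right_mono) auto
  ultimately show ?thesis using that[of ?\<psi> ?\<psi>'] assms by simp
qed

text \<open>The bound and the minimum come from compactness of the unit cube times the interval,
  since every point has a representative in the cube. The function to be maximised is not periodic
  in \<open>y\<close>; there the quadratic growth confines the search to a ball.\<close>

lemma
  fixes u :: "real ^ 'n \<Rightarrow> real \<Rightarrow> real"
  assumes per: "\<And>t. 0 \<le> t \<Longrightarrow> periodic (\<lambda>x. u x t)"
    and cont: "continuous_on (UNIV \<times> {0..}) (\<lambda>(x, t). u x t)"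
    and t: "0 \<le> t\<^sub>1"
  shows periodic_continuous_bounded: "\<exists>B\<ge>0. \<forall>y. \<forall>s\<in>{t\<^sub>1..t\<^sub>2}. \<bar>u y s\<bar> \<le> B"
    and periodic_continuous_attains_inf: "t\<^sub>1 \<le> t\<^sub>2 \<Longrightarrow> continuous_on UNIV \<psi> \<Longrightarrow>
      \<exists>y\<^sub>0. \<exists>t\<^sub>0\<in>{t\<^sub>1..t\<^sub>2}. \<forall>y. \<forall>s\<in>{t\<^sub>1..t\<^sub>2}. u y\<^sub>0 t\<^sub>0 - \<psi> t\<^sub>0 \<le> u y s - \<psi> s"
    and periodic_continuous_attains_sup: "t\<^sub>1 \<le> t\<^sub>2 \<Longrightarrow> continuous_on UNIV \<psi> \<Longrightarrow> 0 \<le> a \<Longrightarrow> 0 < q \<Longrightarrow>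
      \<exists>y\<^sub>0. \<exists>t\<^sub>0\<in>{t\<^sub>1..t\<^sub>2}. \<forall>y. \<forall>s\<in>{t\<^sub>1..t\<^sub>2}.
        u y s - (a * norm (y - x) + q * (norm (y - x))\<^sup>2) - \<psi> s
          \<le> u y\<^sub>0 t\<^sub>0 - (a * norm (y\<^sub>0 - x) + q * (norm (y\<^sub>0 - x))\<^sup>2) - \<psi> t\<^sub>0"
proof -
  let ?Q = "cbox (0 :: real ^ 'n) 1"
  have ne: "(0 :: real ^ 'n) \<in> ?Q" by (simp add: mem_box_cart)
  have rep: "\<exists>y'\<in>?Q. \<forall>s\<ge>0. u y s = u y' s" for y
  proof -
    obtain y' where "torus_eq y' y" "y' \<in> ?Q" by (rule torus_eq_cbox)
    then show ?thesis using per unfolding periodic_def by metis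
  qed
  have cont': "continuous_on (K \<times> {t\<^sub>1..t\<^sub>2}) (\<lambda>z. u (fst z) (snd z))" for K
    by (rule continuous_on_subset[OF cont[unfolded case_prod_beta']]) (use t in auto)
  have cpt: "compact (?Q \<times> {t\<^sub>1..t\<^sub>2})" by (intro compact_Times compact_cbox) auto
  have "bounded ((\<lambda>z. u (fst z) (snd z)) ` (?Q \<times> {t\<^sub>1..t\<^sub>2}))"
    by (intro compact_imp_bounded compact_continuous_image cont' cpt)
  then obtain B where B: "\<And>y s. y \<in> ?Q \<Longrightarrow> s \<in> {t\<^sub>1..t\<^sub>2} \<Longrightarrow> \<bar>u y s\<bar> \<le> B"
    unfolding bounded_iff by fastforce
  have "\<bar>u y s\<bar> \<le> max B 0" if "s \<in> {t\<^sub>1..t\<^sub>2}" for y s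
    using rep[of y] B that t by fastforce
  then show bdd: "\<exists>B\<ge>0. \<forall>y. \<forall>s\<in>{t\<^sub>1..t\<^sub>2}. \<bar>u y s\<bar> \<le> B"
    by (intro exI[of _ "max B 0"]) auto

  assume le: "t\<^sub>1 \<le> t\<^sub>2" and \<psi>: "continuous_on UNIV \<psi>"
  have \<psi>': "continuous_on (K \<times> {t\<^sub>1..t\<^sub>2}) (\<lambda>z. \<psi> (snd z))" for K :: "(real ^ 'n) set"
    by (rule continuous_on_compose2[OF \<psi>]) (auto intro!: continuous_intros)
  have "continuous_on (?Q \<times> {t\<^sub>1..t\<^sub>2}) (\<lambda>z. u (fst z) (snd z) - \<psi> (snd z))"
    by (intro continuous_intros cont' \<psi>')
  moreover have "?Q \<times> {t\<^sub>1..t\<^sub>2} \<noteq> {}" using ne le by auto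
  ultimately obtain z where z: "z \<in> ?Q \<times> {t\<^sub>1..t\<^sub>2}"
    "\<And>w. w \<in> ?Q \<times> {t\<^sub>1..t\<^sub>2} \<Longrightarrow> u (fst z) (snd z) - \<psi> (snd z) \<le> u (fst w) (snd w) - \<psi> (snd w)"
    using continuous_attains_inf[OF cpt] by blast
  have "u (fst z) (snd z) - \<psi> (snd z) \<le> u y s - \<psi> s" if s: "s \<in> {t\<^sub>1..t\<^sub>2}" for y s
  proof -
    obtain y' where y': "y' \<in> ?Q" "u y s = u y' s" using rep[of y] s t by auto
    then show ?thesis using z(2)[of "(y', s)"] s by simp
  qed
  then show "\<exists>y\<^sub>0. \<exists>t\<^sub>0\<in>{t\<^sub>1..t\<^sub>2}. \<forall>y. \<forall>s\<in>{t\<^sub>1..t\<^sub>2}. u y\<^sub>0 t\<^sub>0 - \<psi> t\<^sub>0 \<le> u y s - \<psi> s"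
    using z(1) by (intro exI[of _ "fst z"] bexI[of _ "snd z"]) auto

  assume a: "0 \<le> a" and q: "0 < q"
  let ?w = "\<lambda>y. a * norm (y - x) + q * (norm (y - x))\<^sup>2"
  obtain B where B: "\<And>y s. s \<in> {t\<^sub>1..t\<^sub>2} \<Longrightarrow> \<bar>u y s\<bar> \<le> B" using bdd by blast
  have "bounded (\<psi> ` {t\<^sub>1..t\<^sub>2})"
    by (intro compact_imp_bounded compact_continuous_image continuous_on_subset[OF \<psi>]) auto
  then obtain P where P: "\<And>s. s \<in> {t\<^sub>1..t\<^sub>2} \<Longrightarrow> \<bar>\<psi> s\<bar> \<le> P"
    unfolding bounded_iff by fastforce
  \<comment> \<open>Beyond this radius the quadratic term is at least \<open>2 * B + 2 * P\<close>,
    the most that \<open>u - \<psi>\<close> can gain over its value at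
    \<open>(x, t\<^sub>1)\<close>.\<close>
  define r where "r = sqrt ((2 * B + 2 * P) / q)"
  have BP: "0 \<le> B" "0 \<le> P" using B[of t\<^sub>1 0] P[of t\<^sub>1] le by auto
  have far: "u y s - ?w y - \<psi> s \<le> u x t\<^sub>1 - ?w x - \<psi> t\<^sub>1"
    if "s \<in> {t\<^sub>1..t\<^sub>2}" "y \<notin> cball x r" for y s
  proof -
    have "r \<le> norm (y - x)" using that(2) by (simp add: dist_norm norm_minus_commute)
    then have "r\<^sup>2 \<le> (norm (y - x))\<^sup>2" using BP q by (intro power_mono) (auto simp: r_def)
    then have "q * r\<^sup>2 \<le> q * (norm (y - x))\<^sup>2" using q by simp
    moreover have "q * r\<^sup>2 = 2 * B + 2 * P" using BP q by (simp add: r_def)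
    moreover have "0 \<le> a * norm (y - x)" using a by simp
    moreover have "t\<^sub>1 \<in> {t\<^sub>1..t\<^sub>2}" using le by simp
    ultimately show ?thesis
      using B[OF that(1), of y] B[of t\<^sub>1 x] P[OF that(1)] P[of t\<^sub>1] by (simp add: abs_le_iff)
  qed
  have cpt: "compact (cball x r \<times> {t\<^sub>1..t\<^sub>2})" by (intro compact_Times compact_cball) auto
  have "continuous_on (cball x r \<times> {t\<^sub>1..t\<^sub>2}) (\<lambda>z. u (fst z) (snd z) - ?w (fst z) - \<psi> (snd z))"
    by (intro continuous_intros cont' \<psi>')
  moreover have x_in: "(x, t\<^sub>1) \<in> cball x r \<times> {t\<^sub>1..t\<^sub>2}" using le BP q by (auto simp: r_def)
  ultimately obtain z where z: "z \<in> cball x r \<times> {t\<^sub>1..t\<^sub>2}"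
    "\<And>w. w \<in> cball x r \<times> {t\<^sub>1..t\<^sub>2} \<Longrightarrow>
      u (fst w) (snd w) - ?w (fst w) - \<psi> (snd w) \<le> u (fst z) (snd z) - ?w (fst z) - \<psi> (snd z)"
    using continuous_attains_sup[OF cpt] by blast
  have "u y s - ?w y - \<psi> s \<le> u (fst z) (snd z) - ?w (fst z) - \<psi> (snd z)"
    if s: "s \<in> {t\<^sub>1..t\<^sub>2}" for y s
  proof (cases "y \<in> cball x r")
    case True
    then show ?thesis using z(2)[of "(y, s)"] s by simp
  next
    case False
    then show ?thesis using far[OF s False] z(2)[OF x_in] by simp
  qed
  then show "\<exists>y\<^sub>0. \<exists>t\<^sub>0\<in>{t\<^sub>1..t\<^sub>2}. \<forall>y. \<forall>s\<in>{t\<^sub>1..t\<^sub>2}. u y s - ?w y - \<psi> s \<le> u y\<^sub>0 t\<^sub>0 - ?w y\<^sub>0 - \<psi> t\<^sub>0"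
    using z(1) by (intro exI[of _ "fst z"] bexI[of _ "snd z"]) auto
qed

lemma continuous_on_time_slice:
  assumes "continuous_on (UNIV \<times> {0..}) (\<lambda>(x, t). u x t)"
  shows "continuous_on {0..} (u y)"
  using continuous_on_compose2[OF assms continuous_on_Pair[OF continuous_on_const[of _ y] continuous_on_id], of "{0..}"]
  by auto

text \<open>If \<open>u x T\<close> were below \<open>m - \<eta>\<close>, the minimum of
  \<open>u + \<psi>\<close> over \<open>{0..2 * T}\<close>, with \<psi> the power barrier, would be
  below \<open>m\<close>. That excludes both end times, and at an interior time testing with
  \<open>- \<psi>\<close> gives a strictly negative Caputo part plus
  \<open>H y\<^sub>0 0 \<le> 0\<close>.\<close>

lemma supersolution_lower_bound:
  fixes u :: "real ^ 'n \<Rightarrow> real \<Rightarrow> real"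
  assumes \<alpha>: "0 < \<alpha>" "\<alpha> < 1"
    and super: "viscosity_supersolution \<alpha> H u"
    and per: "\<And>t. 0 \<le> t \<Longrightarrow> periodic (\<lambda>x. u x t)"
    and cont: "continuous_on (UNIV \<times> {0..}) (\<lambda>(x, t). u x t)"
    and H: "\<And>y. H y 0 \<le> 0"
    and init: "\<And>y. m \<le> u y 0"
    and T: "0 \<le> T"
  shows "m \<le> u x T"
proof (cases "T = 0")
  case True
  then show ?thesis using init by simp
next
  case False
  then have T: "0 < T" using T by simp
  show ?thesis
  proof (rule field_le_epsilon, rule ccontr)
    fix \<eta> :: real assume \<eta>: "0 < \<eta>" and "\<not> m \<le> u x T + \<eta>"
    then have low: "u x T + \<eta> < m" by simp
    obtain B where B: "\<And>y s. s \<in> {0..2 * T} \<Longrightarrow> \<bar>u y s\<bar> \<le> B"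
      using periodic_continuous_bounded[OF per cont] by (metis order_refl)
    obtain \<psi> \<psi>' where \<psi>: "\<And>t. (\<psi> has_real_derivative \<psi>' t) (at t)" "continuous_on UNIV \<psi>'"
      and \<psi>_props: "strict_mono_on {0..} \<psi>" "\<psi> 0 = 0" "\<psi> T = \<eta>" "m + B < \<psi> (2 * T)"
      using power_barrier[OF \<eta> T, of "m + B"] by metis
    have n\<psi>: "((\<lambda>s. - \<psi> s) has_real_derivative - \<psi>' t) (at t)" for t
      by (intro derivative_intros \<psi>)
    have "continuous_on UNIV (\<lambda>s. - \<psi> s)"
      using n\<psi> by (meson DERIV_isCont continuous_at_imp_continuous_on)
    then obtain y\<^sub>0 t\<^sub>0 where t\<^sub>0: "t\<^sub>0 \<in> {0..2 * T}"
      and "\<forall>y. \<forall>s\<in>{0..2 * T}. u y\<^sub>0 t\<^sub>0 - - \<psi> t\<^sub>0 \<le> u y s - - \<psi> s"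
      using periodic_continuous_attains_inf[OF per cont order_refl, of "2 * T" "\<lambda>s. - \<psi> s"] T by auto
    then have min: "u y\<^sub>0 t\<^sub>0 + \<psi> t\<^sub>0 \<le> u y s + \<psi> s" if "s \<in> {0..2 * T}" for y s
      using that by simp
    have V: "u y\<^sub>0 t\<^sub>0 + \<psi> t\<^sub>0 < m" using min[of T x] low \<psi>_props T by simp
    have "t\<^sub>0 \<noteq> 0" using V init[of y\<^sub>0] \<psi>_props by auto
    moreover have "t\<^sub>0 \<noteq> 2 * T" using V B[OF t\<^sub>0, of y\<^sub>0] \<psi>_props by auto
    ultimately have t\<^sub>0': "0 < t\<^sub>0" "t\<^sub>0 < 2 * T" using t\<^sub>0 by auto
    define \<delta> where "\<delta> = min (t\<^sub>0 / 2) (2 * T - t\<^sub>0)"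
    have \<delta>: "0 < \<delta>" "\<delta> < t\<^sub>0" "t\<^sub>0 + \<delta> \<le> 2 * T" using t\<^sub>0' by (auto simp: \<delta>_def min_def)
    have "0 \<le> caputo_tail \<alpha> (t\<^sub>0 - \<delta>) (u y\<^sub>0) t\<^sub>0
        + caputo_between \<alpha> (t\<^sub>0 - \<delta>) t\<^sub>0 (\<lambda>s. - \<psi> s) t\<^sub>0 + H y\<^sub>0 0"
    proof (rule supersolution_time_test[OF super n\<psi> _ \<delta>(1,2)])
      show "continuous_on UNIV (\<lambda>t. - \<psi>' t)" by (intro continuous_intros \<psi>)
      show "u y\<^sub>0 t\<^sub>0 - - \<psi> t\<^sub>0 \<le> u y s - - \<psi> s" if "t\<^sub>0 - \<delta> \<le> s" "s \<le> t\<^sub>0 + \<delta>" for y s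
        using min[of s y] that \<delta> by simp
    qed
    \<comment> \<open>Minimality of \<open>u + \<psi>\<close> is maximality of
      \<open>- u - \<psi>\<close>, so the positivity lemma applies to \<open>- u\<close>.\<close>
    moreover have "0 < caputo_tail \<alpha> (t\<^sub>0 - \<delta>) (\<lambda>s. - u y\<^sub>0 s) t\<^sub>0 + caputo_between \<alpha> (t\<^sub>0 - \<delta>) t\<^sub>0 \<psi> t\<^sub>0"
    proof (rule caputo_increasing_pos[OF \<alpha> \<delta>(1,2) _ \<psi>_props(1)])
      show "continuous_on {0..} (\<lambda>s. - u y\<^sub>0 s)"
        by (intro continuous_intros continuous_on_time_slice[OF cont])
      show "\<psi> t\<^sub>0 - \<psi> s \<le> - u y\<^sub>0 t\<^sub>0 - - u y\<^sub>0 s" if "0 \<le> s" "s \<le> t\<^sub>0" for s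
        using min[of s y\<^sub>0] that t\<^sub>0' by simp
    qed
    ultimately show False
      using H[of y\<^sub>0] by (simp add: caputo_tail_uminus caputo_between_uminus)
  qed
qed

text \<open>The paraboloid is a stationary supersolution: its gradient has norm
  \<open>2 * K * norm (y - z)\<close>, and \<nu> times this dominates
  \<open>L * norm (y - z)\<close>. A positive excess of \<open>u\<close> over it is therefore
  excluded by the same barrier argument as for the lower bound.\<close>

lemma subsolution_quadratic_bound:
  fixes u :: "real ^ 'n \<Rightarrow> real \<Rightarrow> real"
  assumes \<alpha>: "0 < \<alpha>" "\<alpha> < 1"
    and sub: "viscosity_subsolution \<alpha> H u"
    and per: "\<And>t. 0 \<le> t \<Longrightarrow> periodic (\<lambda>x. u x t)"
    and cont: "continuous_on (UNIV \<times> {0..}) (\<lambda>(x, t). u x t)"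
    and H: "\<And>y p. \<nu> * norm p - L * norm (y - z) \<le> H y p"
    and K: "0 < K" "L \<le> 2 * \<nu> * K"
    and init: "\<And>y. u y 0 \<le> A + K * (norm (y - z))\<^sup>2"
    and T: "0 \<le> T"
  shows "u x T \<le> A + K * (norm (x - z))\<^sup>2"
proof (cases "T = 0")
  case True
  then show ?thesis using init by simp
next
  case False
  then have T: "0 < T" using T by simp
  show ?thesis
  proof (rule field_le_epsilon, rule ccontr)
    fix \<eta> :: real assume \<eta>: "0 < \<eta>" and "\<not> u x T \<le> A + K * (norm (x - z))\<^sup>2 + \<eta>"
    then have high: "A + K * (norm (x - z))\<^sup>2 + \<eta> < u x T" by simp
    obtain B where B: "\<And>y s. s \<in> {0..2 * T} \<Longrightarrow> \<bar>u y s\<bar> \<le> B"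
      using periodic_continuous_bounded[OF per cont] by (metis order_refl)
    obtain \<psi> \<psi>' where \<psi>: "\<And>t. (\<psi> has_real_derivative \<psi>' t) (at t)" "continuous_on UNIV \<psi>'"
      and \<psi>_props: "strict_mono_on {0..} \<psi>" "\<psi> 0 = 0" "\<psi> T = \<eta>" "B - A < \<psi> (2 * T)"
      using power_barrier[OF \<eta> T, of "B - A"] by metis
    have "continuous_on UNIV \<psi>"
      using \<psi>(1) by (meson DERIV_isCont continuous_at_imp_continuous_on)
    then obtain y\<^sub>0 t\<^sub>0 where t\<^sub>0: "t\<^sub>0 \<in> {0..2 * T}"
      and max: "\<And>y s. s \<in> {0..2 * T} \<Longrightarrow>
        u y s - K * (norm (y - z))\<^sup>2 - \<psi> s \<le> u y\<^sub>0 t\<^sub>0 - K * (norm (y\<^sub>0 - z))\<^sup>2 - \<psi> t\<^sub>0"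
      using periodic_continuous_attains_sup[OF per cont order_refl, of "2 * T" \<psi> 0 K z] T K by fastforce
    have V: "A < u y\<^sub>0 t\<^sub>0 - K * (norm (y\<^sub>0 - z))\<^sup>2 - \<psi> t\<^sub>0" using max[of T x] high \<psi>_props T by simp
    have "t\<^sub>0 \<noteq> 0" using V init[of y\<^sub>0] \<psi>_props by auto
    moreover have "0 \<le> K * (norm (y\<^sub>0 - z))\<^sup>2" using K by simp
    then have "t\<^sub>0 \<noteq> 2 * T" using V B[OF t\<^sub>0, of y\<^sub>0] \<psi>_props by auto
    ultimately have t\<^sub>0': "0 < t\<^sub>0" "t\<^sub>0 < 2 * T" using t\<^sub>0 by auto
    \<comment> \<open>The window must stay within positive times and within
      \<open>{0..2 * T}\<close>; \<open>1 / 8\<close> is the radius on which the periodic test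
      function dominates the paraboloid.\<close>
    define \<delta> where "\<delta> = Min {t\<^sub>0 / 2, 2 * T - t\<^sub>0, 1 / 8}"
    have \<delta>: "0 < \<delta>" "\<delta> < t\<^sub>0" "t\<^sub>0 + \<delta> \<le> 2 * T" "\<delta> \<le> 1 / 8" using t\<^sub>0' by (auto simp: \<delta>_def min_def)
    have "caputo_tail \<alpha> (t\<^sub>0 - \<delta>) (u y\<^sub>0) t\<^sub>0 + caputo_between \<alpha> (t\<^sub>0 - \<delta>) t\<^sub>0 \<psi> t\<^sub>0
        + H y\<^sub>0 ((2 * K) *\<^sub>R (y\<^sub>0 - z)) \<le> 0"
      using max \<delta> by (intro subsolution_quadratic_test[OF sub per \<psi> \<delta>(1,2,4)]) auto
    moreover have "0 < caputo_tail \<alpha> (t\<^sub>0 - \<delta>) (u y\<^sub>0) t\<^sub>0 + caputo_between \<alpha> (t\<^sub>0 - \<delta>) t\<^sub>0 \<psi> t\<^sub>0"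
    proof (rule caputo_increasing_pos[OF \<alpha> \<delta>(1,2) continuous_on_time_slice[OF cont] \<psi>_props(1)])
      show "\<psi> t\<^sub>0 - \<psi> s \<le> u y\<^sub>0 t\<^sub>0 - u y\<^sub>0 s" if "0 \<le> s" "s \<le> t\<^sub>0" for s
        using max[of s y\<^sub>0] that t\<^sub>0' by simp
    qed
    moreover have "0 \<le> H y\<^sub>0 ((2 * K) *\<^sub>R (y\<^sub>0 - z))"
      using H[of "(2 * K) *\<^sub>R (y\<^sub>0 - z)" y\<^sub>0] mult_right_mono[OF K(2), of "norm (y\<^sub>0 - z)"] K(1)
      by (simp add: mult_ac)
    ultimately show False by linarith
  qed
qed

section \<open>Propagation of asymptotic upper bounds along a cone\<close>

text \<open>Factor the difference of squares as \<open>(t - s) * ((t - c) + (s - c))\<close>. As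
  \<open>t - c \<ge> - R\<close> and \<open>s - c \<ge> - 2 * R\<close>, the second factor is at
  least \<open>- 3 * R\<close>; the resulting slope is small for large \<open>R\<close>.\<close>

lemma square_diff_ge:
  fixes \<beta> R t s c :: real
  assumes "0 \<le> \<beta>" "0 < R" "\<bar>t - c\<bar> \<le> R" "t - R \<le> s" "s \<le> t"
  shows "- (3 * \<beta> / R * (t - s)) \<le> \<beta> * ((t - c) / R)\<^sup>2 - \<beta> * ((s - c) / R)\<^sup>2"
proof -
  have "- (3 * R) \<le> (t - c) + (s - c)" using assms by linarith
  then have "(t - s) * - (3 * R) \<le> (t - s) * ((t - c) + (s - c))"
    using assms by (intro mult_left_mono) auto
  then have "\<beta> * ((t - s) * - (3 * R)) / R\<^sup>2 \<le> \<beta> * ((t - s) * ((t - c) + (s - c))) / R\<^sup>2"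
    using assms by (intro divide_right_mono mult_left_mono) auto
  moreover have "\<beta> * ((t - s) * - (3 * R)) / R\<^sup>2 = - (3 * \<beta> / R * (t - s))"
    using assms by (simp add: power2_eq_square field_simps)
  moreover have "\<beta> * ((t - s) * ((t - c) + (s - c))) / R\<^sup>2 = \<beta> * ((t - c) / R)\<^sup>2 - \<beta> * ((s - c) / R)\<^sup>2"
    using assms by (simp add: power_divide diff_divide_distrib[symmetric] right_diff_distrib[symmetric])
      (simp add: power2_eq_square algebra_simps)
  ultimately show ?thesis by simp
qed

lemma exists_large_powr_small:
  fixes \<alpha> k e :: real
  assumes "0 < \<alpha>" "0 < e"
  obtains R where "1 \<le> R" "k * R powr (- \<alpha>) < e"
proof -
  have "((\<lambda>R. k * R powr (- \<alpha>)) \<longlongrightarrow> k * 0) at_top"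
    by (intro tendsto_mult tendsto_const tendsto_neg_powr) (use assms filterlim_ident in auto)
  then have "eventually (\<lambda>R. k * R powr (- \<alpha>) < e) at_top"
    using assms by (intro order_tendstoD) auto
  then have "eventually (\<lambda>R. 1 \<le> R \<and> k * R powr (- \<alpha>) < e) at_top"
    by (intro eventually_conj eventually_ge_at_top)
  then show ?thesis using that eventually_happens'[OF trivial_limit_at_top_linorder] by blast
qed

text \<open>If the asymptotic excess of \<open>u\<close> over the cone \<open>w\<close> exceeded
  \<open>c\<close>, a slowly penalised maximum at a late time would lie off the vertex. There the
  Hamiltonian is at least \<kappa>, while the Caputo part is above \<open>- \<kappa>\<close>. The
  extra slope \<open>\<kappa> / \<nu>\<close> thus pays for the time derivative.\<close>

lemma subsolution_cone_bound:
  fixes u :: "real ^ 'n \<Rightarrow> real \<Rightarrow> real"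
  assumes \<alpha>: "0 < \<alpha>" "\<alpha> < 1"
    and sub: "viscosity_subsolution \<alpha> H u"
    and per: "\<And>t. 0 \<le> t \<Longrightarrow> periodic (\<lambda>x. u x t)"
    and cont: "continuous_on (UNIV \<times> {0..}) (\<lambda>(x, t). u x t)"
    and bdd: "\<And>y t. 0 \<le> t \<Longrightarrow> \<bar>u y t\<bar> \<le> M"
    and H: "\<And>y p. \<nu> * norm p - (k + L * norm (y - x)) \<le> H y p"
    and pos: "0 < \<nu>" "0 < L" "0 \<le> k" "0 < \<kappa>"
    and vertex: "\<And>\<eta>. 0 < \<eta> \<Longrightarrow> eventually (\<lambda>t. u x t \<le> c + \<eta>) at_top"
    and \<eta>: "0 < \<eta>"
  shows "eventually (\<lambda>t. \<forall>y. u y t \<le> c + ((k + \<kappa>) / \<nu> * norm (y - x) + L / (2 * \<nu>) * (norm (y - x))\<^sup>2) + \<eta>) at_top"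
proof -
  define a where "a = (k + \<kappa>) / \<nu>"
  define w where "w y = a * norm (y - x) + L / (2 * \<nu>) * (norm (y - x))\<^sup>2" for y
  \<comment> \<open>The infimum of these eventual bounds is the upper limit, as time tends to
    infinity, of the supremum of \<open>u - w\<close> over space.\<close>
  define A where "A = {b. eventually (\<lambda>t. \<forall>y. u y t - w y \<le> b) at_top}"
  define S where "S = Inf A"
  have a: "0 < a" using pos by (simp add: a_def)
  have w_nonneg: "0 \<le> w y" for y using a pos by (simp add: w_def)
  have w_x: "w x = 0" by (simp add: w_def)
  have "M \<in> A"
    unfolding A_def mem_Collect_eq
  proof (rule eventually_at_top_linorderI[of 0], intro allI)
    fix t y assume "(0::real) \<le> t"
    then show "u y t - w y \<le> M" using bdd[of t y] w_nonneg[of y] by linarith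
  qed
  then have A_ne: "A \<noteq> {}" by blast
  have "- M \<le> b" if b: "b \<in> A" for b
  proof -
    from b have "eventually (\<lambda>t. (\<forall>y. u y t - w y \<le> b) \<and> 0 \<le> t) at_top"
      unfolding A_def by (intro eventually_conj eventually_ge_at_top) auto
    then obtain t where "u x t - w x \<le> b" "0 \<le> t"
      using eventually_happens'[OF trivial_limit_at_top_linorder] by blast
    then show ?thesis using bdd[of t x] w_x by linarith
  qed
  then have A_bdd: "bdd_below A" by (rule bdd_belowI)
  have S_above: "eventually (\<lambda>t. \<forall>y. u y t - w y \<le> S + e) at_top" if "0 < e" for e
  proof -
    have "Inf A < S + e" using that by (simp add: S_def)
    then obtain b where "b \<in> A" "b < S + e" using cInf_less_iff[OF A_ne A_bdd] by blast
    then have "eventually (\<lambda>t. \<forall>y. u y t - w y \<le> b) at_top" by (simp add: A_def)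
    then show ?thesis
      by eventually_elim (use \<open>b < S + e\<close> in \<open>auto intro: order_trans less_imp_le\<close>)
  qed
  have "S \<le> c"
  proof (rule ccontr)
    assume "\<not> S \<le> c"
    \<comment> \<open>A quarter of the gap leaves the late values at the vertex, at most
      \<open>c + e\<close>, strictly below the level \<open>S - e\<close>, which the penalised
      maximum will exceed.\<close>
    define e where "e = (S - c) / 4"
    have e: "0 < e" "c + e < S - e" using \<open>\<not> S \<le> c\<close> by (auto simp: e_def field_simps)
    define \<beta> where "\<beta> = 3 * e"
    \<comment> \<open>The window slope \<open>3 * \<beta> / R\<close> is charged twice, once in the
      tail and once in the piece next to \<open>t\<^sub>0\<close>, hence the \<open>6\<close>;
      before the window \<open>u\<close> varies by at most \<open>2 * M\<close>.\<close>
    obtain R where R: "1 \<le> R" "(6 * \<beta> / (1 - \<alpha>) + 2 * M / \<alpha>) * R powr (- \<alpha>) < \<kappa>"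
      using exists_large_powr_small[OF \<alpha>(1) pos(4)] by blast
    have "eventually (\<lambda>t. (\<forall>y. u y t - w y \<le> S + e) \<and> u x t \<le> c + e) at_top"
      by (intro eventually_conj S_above vertex e)
    then obtain T' where T': "\<And>t. T' \<le> t \<Longrightarrow> (\<forall>y. u y t - w y \<le> S + e) \<and> u x t \<le> c + e"
      by (auto simp: eventually_at_top_linorder)
    define T where "T = max T' 0"
    have T: "u y t - w y \<le> S + e" "u x t \<le> c + e" "0 \<le> t" if "T \<le> t" for y t
      using T'[of t] that by (auto simp: T_def)
    have "S - e \<notin> A"
      using cInf_lower[OF _ A_bdd, of "S - e"] e by (auto simp: S_def)
    \<comment> \<open>The margin \<open>2 * R + 1\<close> keeps \<open>t\<^sub>0 - R\<close> beyond
      \<open>T\<close> for every \<open>t\<^sub>0\<close> within distance \<open>R\<close> of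
      \<open>t'\<close>.\<close>
    then obtain t' where "T + 2 * R + 1 \<le> t'" "\<not> (\<forall>y. u y t' - w y \<le> S - e)"
      unfolding A_def eventually_at_top_linorder by blast
    then obtain y' where t': "T + 2 * R + 1 \<le> t'" and y': "S - e < u y' t' - w y'"
      by (auto simp: not_le)
    define \<psi> where "\<psi> s = \<beta> * ((s - t') / R)\<^sup>2" for s
    define \<psi>' where "\<psi>' s = \<beta> * (2 * ((s - t') / R) * (1 / R))" for s
    have \<beta>: "0 < \<beta>" using e by (simp add: \<beta>_def)
    have \<psi>_deriv: "(\<psi> has_real_derivative \<psi>' t) (at t)" for t
      unfolding \<psi>_def \<psi>'_def using R by (auto intro!: derivative_eq_intros)
    have \<psi>_cont: "continuous_on UNIV \<psi>'" "continuous_on UNIV \<psi>"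
      unfolding \<psi>_def \<psi>'_def using R by (auto intro!: continuous_intros)
    have \<psi>_nonneg: "0 \<le> \<psi> s" for s using \<beta> by (simp add: \<psi>_def)
    have \<psi>_far: "\<beta> \<le> \<psi> s" if "R \<le> \<bar>s - t'\<bar>" for s
    proof -
      have "1 \<le> \<bar>(s - t') / R\<bar>" using that R by (simp add: field_simps)
      then have "1 \<le> \<bar>(s - t') / R\<bar>\<^sup>2" by (rule one_le_power)
      then have "1 \<le> ((s - t') / R)\<^sup>2" by (simp only: power2_abs)
      then show ?thesis using \<beta> mult_left_mono[of 1 _ \<beta>] by (simp add: \<psi>_def)
    qed
    have I: "0 \<le> t' - R" "t' - R \<le> t' + R" using t' R T_def by auto
    obtain y\<^sub>0 t\<^sub>0 where t\<^sub>0: "t\<^sub>0 \<in> {t' - R..t' + R}" and max\<^sub>0: "\<forall>y. \<forall>s\<in>{t' - R..t' + R}.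
        u y s - (a * norm (y - x) + L / (2 * \<nu>) * (norm (y - x))\<^sup>2) - \<psi> s
          \<le> u y\<^sub>0 t\<^sub>0 - (a * norm (y\<^sub>0 - x) + L / (2 * \<nu>) * (norm (y\<^sub>0 - x))\<^sup>2) - \<psi> t\<^sub>0"
      using periodic_continuous_attains_sup[OF per cont I(1) I(2) \<psi>_cont(2) less_imp_le[OF a],
          of "L / (2 * \<nu>)" x] pos by auto
    define V where "V = u y\<^sub>0 t\<^sub>0 - w y\<^sub>0 - \<psi> t\<^sub>0"
    have max\<^sub>1: "u y s - w y - \<psi> s \<le> V" if "s \<in> {t' - R..t' + R}" for y s
      using max\<^sub>0 that by (simp add: V_def w_def)
    have V: "S - e < V"
      using max\<^sub>1[of t' y'] y' R by (simp add: \<psi>_def)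
    \<comment> \<open>Outside the window the penalty is at least \<open>3 * e\<close>, so the value
      is at most \<open>S + e - 3 * e\<close>, below \<open>S - e\<close> and hence below
      \<open>V\<close>. The maximum is thus valid for all times from \<open>T\<close> on, even if
      \<open>t\<^sub>0\<close> is an endpoint of the window.\<close>
    have max: "u y s - w y - \<psi> s \<le> V" if s: "T \<le> s" for y s
    proof (cases "s \<in> {t' - R..t' + R}")
      case True
      then show ?thesis by (rule max\<^sub>1)
    next
      case False
      then have "\<beta> \<le> \<psi> s" by (intro \<psi>_far) auto
      then show ?thesis using T(1)[OF s, of y] V e(1) by (simp add: \<beta>_def)
    qed
    have t\<^sub>0_T: "T + R + 1 \<le> t\<^sub>0" using t\<^sub>0 t' by auto
    have t\<^sub>0_near: "\<bar>t\<^sub>0 - t'\<bar> \<le> R" using t\<^sub>0 by auto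
    \<comment> \<open>At the vertex, where the cone is not differentiable, the penalised value is at
      most \<open>c + e < S - e < V\<close>.\<close>
    have "y\<^sub>0 \<noteq> x"
      using V T(2)[of t\<^sub>0] t\<^sub>0_T R e \<psi>_nonneg[of t\<^sub>0] by (auto simp: V_def w_x)
    define r where "r = norm (y\<^sub>0 - x)"
    have r: "0 < r" using \<open>y\<^sub>0 \<noteq> x\<close> by (simp add: r_def)
    define q where "q = a / (2 * r) + L / (2 * \<nu>)"
    \<comment> \<open>By AM-GM the cone lies below a paraboloid that touches it at \<open>y\<^sub>0\<close>.\<close>
    have w_le: "w y \<le> q * (norm (y - x))\<^sup>2 + a * r / 2" for y
    proof -
      have "2 * norm (y - x) * r \<le> (norm (y - x))\<^sup>2 + r\<^sup>2" by (rule sum_squares_bound)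
      then have "norm (y - x) \<le> ((norm (y - x))\<^sup>2 + r\<^sup>2) / (2 * r)" using r by (simp add: field_simps)
      then have "a * norm (y - x) \<le> a * (((norm (y - x))\<^sup>2 + r\<^sup>2) / (2 * r))"
        using a by (intro mult_left_mono) auto
      also have "\<dots> = a / (2 * r) * (norm (y - x))\<^sup>2 + a * r / 2"
        using r by (simp add: field_simps power2_eq_square)
      finally show ?thesis by (simp add: w_def q_def distrib_right)
    qed
    have w_eq: "w y\<^sub>0 = q * (norm (y\<^sub>0 - x))\<^sup>2 + a * r / 2"
      using r unfolding w_def q_def r_def[symmetric] by (simp add: field_simps power2_eq_square)
    have \<delta>: "0 < (1 / 8 :: real)" "1 / 8 < t\<^sub>0" "1 / 8 \<le> R" "T \<le> t\<^sub>0 - 1 / 8" "T \<le> t\<^sub>0 - R"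
      using t\<^sub>0_T R T_def by auto
    have test: "caputo_tail \<alpha> (t\<^sub>0 - 1 / 8) (u y\<^sub>0) t\<^sub>0 + caputo_between \<alpha> (t\<^sub>0 - 1 / 8) t\<^sub>0 \<psi> t\<^sub>0
        + H y\<^sub>0 ((2 * q) *\<^sub>R (y\<^sub>0 - x)) \<le> 0"
    proof (rule subsolution_quadratic_test[OF sub per \<psi>_deriv \<psi>_cont(1) \<delta>(1,2) order_refl])
      fix y s assume "t\<^sub>0 - 1 / 8 \<le> s"
      then show "u y s - q * (norm (y - x))\<^sup>2 - \<psi> s \<le> u y\<^sub>0 t\<^sub>0 - q * (norm (y\<^sub>0 - x))\<^sup>2 - \<psi> t\<^sub>0"
        using max[of s y] w_le[of y] w_eq \<delta>(4) unfolding V_def by linarith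
    qed
    define l where "l = 3 * \<beta> / R"
    have l: "0 \<le> l" using \<beta> R by (simp add: l_def)
    have \<psi>_near: "- (l * (t\<^sub>0 - s)) \<le> \<psi> t\<^sub>0 - \<psi> s" if "t\<^sub>0 - R \<le> s" "s \<le> t\<^sub>0" for s
      unfolding \<psi>_def l_def using \<beta> R t\<^sub>0_near that by (intro square_diff_ge) auto
    \<comment> \<open>By maximality \<open>u y\<^sub>0\<close> inherits the one-sided slope bound of
      \<psi> on the window of length \<open>R\<close> before \<open>t\<^sub>0\<close>; earlier only
      the uniform bound on \<open>u\<close> is used.\<close>
    have tail: "- l * (R powr (1 - \<alpha>) / (1 - \<alpha>)) - 2 * M * (R powr - \<alpha> / \<alpha>)
        \<le> caputo_tail \<alpha> (t\<^sub>0 - 1 / 8) (u y\<^sub>0) t\<^sub>0"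
    proof (rule caputo_tail_ge[OF \<alpha> \<delta>(1,3) continuous_on_time_slice[OF cont] l])
      fix s assume s: "t\<^sub>0 - R \<le> s" "s \<le> t\<^sub>0 - 1 / 8"
      then have "T \<le> s" using \<delta>(5) by simp
      then have "\<psi> t\<^sub>0 - \<psi> s \<le> u y\<^sub>0 t\<^sub>0 - u y\<^sub>0 s" using max[of s y\<^sub>0] by (simp add: V_def)
      then show "- (l * (t\<^sub>0 - s)) \<le> extend_past (u y\<^sub>0) t\<^sub>0 - extend_past (u y\<^sub>0) s"
        using \<psi>_near[OF s(1)] s T(3)[OF \<open>T \<le> s\<close>] by (simp add: extend_past_max)
    next
      fix s
      show "- (2 * M) \<le> extend_past (u y\<^sub>0) t\<^sub>0 - extend_past (u y\<^sub>0) s"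
        using bdd[of "max t\<^sub>0 0" y\<^sub>0] bdd[of "max s 0" y\<^sub>0] by (simp add: extend_past_max abs_le_iff)
    qed
    have "- l * ((1 / 8) powr (1 - \<alpha>) / (1 - \<alpha>)) \<le> caputo_between \<alpha> (t\<^sub>0 - 1 / 8) t\<^sub>0 \<psi> t\<^sub>0"
      using \<psi>_near \<delta> by (intro caputo_between_ge \<alpha> l) auto
    moreover have "l * ((1 / 8) powr (1 - \<alpha>) / (1 - \<alpha>)) \<le> l * (R powr (1 - \<alpha>) / (1 - \<alpha>))"
      using l \<alpha> \<delta> by (intro mult_left_mono divide_right_mono powr_mono2) auto
    moreover have "R powr (1 - \<alpha>) = R * R powr (- \<alpha>)"
      using R by (simp add: powr_diff powr_minus divide_inverse)
    then have "l * (R powr (1 - \<alpha>) / (1 - \<alpha>)) = 3 * \<beta> / (1 - \<alpha>) * R powr (- \<alpha>)"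
      using R by (simp add: l_def)
    moreover have "(6 * \<beta> / (1 - \<alpha>) + 2 * M / \<alpha>) * R powr (- \<alpha>)
        = 2 * (3 * \<beta> / (1 - \<alpha>) * R powr (- \<alpha>)) + 2 * M * (R powr - \<alpha> / \<alpha>)"
      by (simp add: distrib_right)
    ultimately have caputo: "- \<kappa> < caputo_tail \<alpha> (t\<^sub>0 - 1 / 8) (u y\<^sub>0) t\<^sub>0 + caputo_between \<alpha> (t\<^sub>0 - 1 / 8) t\<^sub>0 \<psi> t\<^sub>0"
      using tail R(2) by linarith
    \<comment> \<open>The paraboloid has the slope of the cone at \<open>y\<^sub>0\<close>, namely
      \<open>a + L * r / \<nu>\<close>; the choice of \<open>a\<close> leaves exactly \<kappa> after
      subtracting \<open>k + L * r\<close>.\<close>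
    have "norm ((2 * q) *\<^sub>R (y\<^sub>0 - x)) = 2 * q * r"
      using a r pos by (simp add: r_def q_def)
    also have "\<nu> * (2 * q * r) = k + \<kappa> + L * r"
      using r pos by (simp add: q_def a_def field_simps)
    finally have "\<kappa> \<le> H y\<^sub>0 ((2 * q) *\<^sub>R (y\<^sub>0 - x))"
      using H[of "(2 * q) *\<^sub>R (y\<^sub>0 - x)" y\<^sub>0] by (simp add: r_def)
    then show False using test caputo by linarith
  qed
  show ?thesis
    using S_above[OF \<eta>]
    by eventually_elim (use \<open>S \<le> c\<close> in \<open>auto simp: w_def a_def algebra_simps intro: order_trans\<close>)
qed

text \<open>For a fixed target point the auxiliary \<kappa> of the cone bound is chosen so small
  that its cost \<open>\<kappa> * r / \<nu>\<close> is at most \<open>\<eta> / 2\<close>; dividing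
  by \<open>r + 1\<close> also covers \<open>r = 0\<close>.\<close>

lemma subsolution_propagation:
  fixes u :: "real ^ 'n \<Rightarrow> real \<Rightarrow> real"
  assumes \<alpha>: "0 < \<alpha>" "\<alpha> < 1"
    and sub: "viscosity_subsolution \<alpha> H u"
    and per: "\<And>t. 0 \<le> t \<Longrightarrow> periodic (\<lambda>x. u x t)"
    and cont: "continuous_on (UNIV \<times> {0..}) (\<lambda>(x, t). u x t)"
    and bdd: "\<And>y t. 0 \<le> t \<Longrightarrow> \<bar>u y t\<bar> \<le> M"
    and H: "\<And>y p. \<nu> * norm p - (k + L * norm (y - x)) \<le> H y p"
    and pos: "0 < \<nu>" "0 < L" "0 \<le> k"
    and vertex: "\<And>\<eta>. 0 < \<eta> \<Longrightarrow> eventually (\<lambda>t. u x t \<le> c + \<eta>) at_top"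
    and \<eta>: "0 < \<eta>"
  shows "eventually (\<lambda>t. u y t \<le> c + (k * norm (y - x) + L / 2 * (norm (y - x))\<^sup>2) / \<nu> + \<eta>) at_top"
proof -
  define r where "r = norm (y - x)"
  define \<kappa> where "\<kappa> = \<nu> * (\<eta> / 2) / (r + 1)"
  have r: "0 \<le> r" by (simp add: r_def)
  have \<kappa>: "0 < \<kappa>" using pos \<eta> r by (simp add: \<kappa>_def)
  have "\<kappa> / \<nu> * r = \<eta> / 2 * (r / (r + 1))" using pos by (simp add: \<kappa>_def)
  also have "\<dots> \<le> \<eta> / 2 * 1" using r \<eta> by (intro mult_left_mono) auto
  finally have "\<kappa> / \<nu> * r + \<eta> / 2 \<le> \<eta>" by linarith
  moreover have "(k + \<kappa>) / \<nu> * r + L / (2 * \<nu>) * r\<^sup>2 = (k * r + L / 2 * r\<^sup>2) / \<nu> + \<kappa> / \<nu> * r"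
    using pos by (simp add: field_simps)
  moreover have "eventually (\<lambda>t. \<forall>y. u y t \<le> c + ((k + \<kappa>) / \<nu> * norm (y - x)
      + L / (2 * \<nu>) * (norm (y - x))\<^sup>2) + \<eta> / 2) at_top"
    using \<eta> by (intro subsolution_cone_bound[OF \<alpha> sub per cont bdd H pos \<kappa> vertex]) auto
  then have "eventually (\<lambda>t. u y t \<le> c + ((k + \<kappa>) / \<nu> * r + L / (2 * \<nu>) * r\<^sup>2) + \<eta> / 2) at_top"
    by eventually_elim (simp add: r_def)
  ultimately show ?thesis
    unfolding r_def[symmetric] by (auto elim!: eventually_mono)
qed

section \<open>Global linear growth, and neighbourhoods of the zero set\<close>

text \<open>Since \<open>h 0 = 0\<close>, convexity makes \<open>h p / norm p\<close> nondecreasing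
  along rays. A large \<open>p\<close> is scaled to norm \<open>1 / 2\<close>, and the bound there
  carries over with the same \<nu>.\<close>

lemma convex_linear_lower_bound:
  fixes h :: "'a::real_normed_vector \<Rightarrow> real"
  assumes convex: "convex_on UNIV h" and zero: "h 0 = 0"
    and near: "\<And>p. p \<in> ball 0 1 \<Longrightarrow> \<nu> * norm p \<le> h p"
  shows "\<nu> * norm p \<le> h p"
proof (cases "norm p < 1")
  case True
  then show ?thesis by (intro near) simp
next
  case False
  define \<theta> where "\<theta> = 1 / (2 * norm p)"
  have \<theta>: "0 < \<theta>" "\<theta> \<le> 1" "norm (\<theta> *\<^sub>R p) = 1 / 2"
    using False by (auto simp: \<theta>_def divide_le_eq)
  have "\<nu> * (1 / 2) \<le> h (\<theta> *\<^sub>R p)"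
    using near[of "\<theta> *\<^sub>R p"] unfolding mem_ball_0 \<theta>(3) by simp
  also have "h (\<theta> *\<^sub>R p) \<le> \<theta> * h p"
    using convex_onD[OF convex, of \<theta> 0 p] \<theta> zero by simp
  finally have "\<nu> * (1 / 2) / \<theta> \<le> h p" using \<theta> by (simp add: field_simps)
  then show ?thesis using \<theta> by (simp add: \<theta>_def)
qed

lemma torus_nbhd_less:
  assumes "x \<in> torus_nbhd Z \<epsilon>" "Z \<noteq> {}"
  obtains z where "z \<in> Z" "torus_dist x z < \<epsilon>"
proof -
  have "bdd_below (torus_dist x ` Z)"
    by (rule bdd_belowI[of _ 0]) (auto simp: torus_dist_nonneg)
  then show ?thesis
    using assms that unfolding torus_nbhd_def by (auto simp: cInf_less_iff)
qed

lemma mem_torus_nbhd: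
  assumes "x \<in> Z" "0 < \<epsilon>"
  shows "x \<in> torus_nbhd Z \<epsilon>"
proof -
  have "(INF z\<in>Z. torus_dist x z) \<le> torus_dist x x"
    by (rule cINF_lower[OF _ assms(1)]) (auto intro!: bdd_belowI[of _ 0] simp: torus_dist_nonneg)
  also have "\<dots> \<le> 0" using torus_dist_le_dist[of x x] by simp
  finally show ?thesis using assms by (simp add: torus_nbhd_def)
qed

section \<open>Convergence on the zero set\<close>

theorem theorem4p5:
  fixes \<alpha> D C :: real
    and g f :: "real ^ 'n \<Rightarrow> real"
    and F H :: "real ^ 'n \<Rightarrow> real ^ 'n \<Rightarrow> real"
    and Z :: "(real ^ 'n) set"
    and u :: "real ^ 'n \<Rightarrow> real \<Rightarrow> real"
  assumes alpha: "0 < \<alpha>" "\<alpha> < 1"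
    and g: "periodic g" "torus_lipschitz g"
    and H_def: "H = (\<lambda>x p. F x p - f x)"
    and F_cont: "\<And>p. periodic (\<lambda>x. F x p)" "continuous_on UNIV (\<lambda>(x, p). F x p)"
    and f_cont: "periodic f" "continuous_on UNIV f"
    and F_convex: "\<And>x. convex_on UNIV (F x)"
    and F_zero: "\<And>x. F x 0 = 0"
    and F_pos: "\<And>x p. p \<noteq> 0 \<Longrightarrow> F x p > F x 0"
    and f: "\<And>x. f x \<ge> 0" "torus_lipschitz f" "torus_min f = 0"
    and H_lip: "\<exists>c>0. \<forall>x y p. \<bar>H x p - H y p\<bar> \<le> c * (1 + norm p) * torus_dist x y"
    and H_coercive: "filterlim (\<lambda>p. INF x. H x p) at_top at_infinity"
    and F_lower: "\<And>R. R > 0 \<Longrightarrow> \<exists>\<nu>>0. \<forall>x. \<forall>p\<in>ball 0 R. F x p \<ge> \<nu> * norm p"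
    and Z_def: "Z = argmin_set f"
    and D: "1 \<le> D" "D < 3 / 2"
    and C: "C > 0"
    and chain: "\<exists>\<epsilon>\<^sub>0>0. \<forall>\<epsilon>. 0 < \<epsilon> \<and> \<epsilon> < \<epsilon>\<^sub>0 \<longrightarrow>
      (\<forall>x\<in>torus_nbhd Z \<epsilon>. \<exists>x\<^sub>0\<in>Z \<inter> argmin_set g. \<exists>n xs \<gamma>.
         is_polygonal_line n xs \<gamma> \<and> \<gamma> \<subseteq> torus_nbhd Z \<epsilon> \<and>
         xs 0 = x\<^sub>0 \<and> xs n = x \<and>
         (\<forall>i\<in>{1..n}. torus_dist (xs (i - 1)) (xs i) = \<epsilon>) \<and>
         real n \<le> C * \<epsilon> powr (- D))"
    and u: "viscosity_solution \<alpha> H u" "\<And>x. u x 0 = g x"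
  shows "\<forall>x\<in>Z. ((\<lambda>t. u x t) \<longlongrightarrow> torus_min g) at_top"
proof
  fix x assume x: "x \<in> Z"
  have per: "\<And>t. 0 \<le> t \<Longrightarrow> periodic (\<lambda>x. u x t)"
    and cont: "continuous_on (UNIV \<times> {0..}) (\<lambda>(x, t). u x t)"
    and sub: "viscosity_subsolution \<alpha> H u" and super: "viscosity_supersolution \<alpha> H u"
    using u(1) by (auto simp: viscosity_solution_def)
  define m where "m = torus_min g"
  obtain G where G: "0 < G" "\<And>x y. \<bar>g x - g y\<bar> \<le> G * dist x y"
    using torus_lipschitzE[OF g(2)] by metis
  obtain L where L: "0 < L" "\<And>x y. \<bar>f x - f y\<bar> \<le> L * torus_dist x y" "\<And>x y. \<bar>f x - f y\<bar> \<le> L * dist x y"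
    using torus_lipschitzE[OF f(2)] by metis
  have f_Z: "f z = 0" if "z \<in> Z" for z
    using that f(3) by (simp add: Z_def argmin_set_def)
  obtain \<nu> where \<nu>: "0 < \<nu>" "\<And>x p. p \<in> ball 0 1 \<Longrightarrow> \<nu> * norm p \<le> F x p"
    using F_lower[of 1] by auto
  have F_ge: "\<nu> * norm p \<le> F x p" for x p
    by (rule convex_linear_lower_bound[OF F_convex F_zero \<nu>(2)])
  have H_ge: "\<nu> * norm p - (f y' + L * norm (y - y')) \<le> H y p" for y y' p
    using F_ge[of p y] L(3)[of y y'] by (simp add: H_def dist_norm abs_le_iff)

  \<comment> \<open>\<open>g\<close> is the time slice of \<open>u\<close> over the degenerate
    interval \<open>{0..0}\<close>. Its boundedness makes the infimum \<open>m\<close> a genuine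
    lower bound.\<close>
  obtain B\<^sub>g where B\<^sub>g: "\<And>y. \<bar>g y\<bar> \<le> B\<^sub>g"
    using periodic_continuous_bounded[OF per cont order_refl, of 0] u(2) by auto
  have m_le: "m \<le> g y" for y
    unfolding m_def torus_min_def
    by (rule cINF_lower) (use B\<^sub>g in \<open>auto intro!: bdd_belowI[of _ "- B\<^sub>g"] simp: abs_le_iff\<close>, meson minus_le_iff)
  have u_ge: "m \<le> u y t" if "0 \<le> t" for y t
    by (rule supersolution_lower_bound[OF alpha super per cont _ _ that])
       (use m_le u(2) f(1) F_zero in \<open>auto simp: H_def\<close>)

  \<comment> \<open>The term with \<open>G\<close> comes from AM-GM, \<open>G * r \<le> \<sigma> +
    G\<^sup>2 / (4 * \<sigma>) * r\<^sup>2\<close>, and puts the paraboloid above the initial datum;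
    the term \<open>L / (2 * \<nu>)\<close> makes it a stationary supersolution.\<close>
  have parabola: "u y t \<le> g z + \<sigma> + (L / (2 * \<nu>) + G\<^sup>2 / (4 * \<sigma>)) * (norm (y - z))\<^sup>2"
    if z: "z \<in> Z" and \<sigma>: "0 < \<sigma>" and t: "0 \<le> t" for y z t \<sigma>
  proof (rule subsolution_quadratic_bound[OF alpha sub per cont _ _ _ _ t])
    show "\<nu> * norm p - L * norm (y - z) \<le> H y p" for y p
      using H_ge[of p z y] f_Z[OF z] by simp
    show "0 < L / (2 * \<nu>) + G\<^sup>2 / (4 * \<sigma>)" using L \<nu> \<sigma> by (intro add_pos_nonneg) auto
    have "2 * \<nu> * (L / (2 * \<nu>) + G\<^sup>2 / (4 * \<sigma>)) = L + 2 * \<nu> * (G\<^sup>2 / (4 * \<sigma>))"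
      using \<nu> by (simp add: distrib_left)
    then show "L \<le> 2 * \<nu> * (L / (2 * \<nu>) + G\<^sup>2 / (4 * \<sigma>))" using \<nu> \<sigma> by simp
    fix y
    let ?r = "norm (y - z)"
    have "0 \<le> (G * ?r / 2 - \<sigma>)\<^sup>2 / \<sigma>" using \<sigma> by simp
    also have "\<dots> = \<sigma> + G\<^sup>2 / (4 * \<sigma>) * ?r\<^sup>2 - G * ?r"
      using \<sigma> by (simp add: field_simps power2_eq_square)
    finally have "G * ?r \<le> \<sigma> + G\<^sup>2 / (4 * \<sigma>) * ?r\<^sup>2" by simp
    moreover have "0 \<le> L / (2 * \<nu>) * ?r\<^sup>2" using L \<nu> by simp
    moreover have "g y \<le> g z + G * ?r" using G(2)[of y z] by (simp add: dist_norm abs_le_iff)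
    ultimately show "u y 0 \<le> g z + \<sigma> + (L / (2 * \<nu>) + G\<^sup>2 / (4 * \<sigma>)) * ?r\<^sup>2"
      by (simp add: u(2) distrib_right)
  qed
  \<comment> \<open>At the vertex the quadratic term vanishes for every \<sigma>, so \<sigma> can
    tend to \<open>0\<close>.\<close>
  have u_Z: "u z t \<le> g z" if "z \<in> Z" "0 \<le> t" for z t
    by (rule field_le_epsilon) (use parabola[OF that(1) _ that(2), of _ z] in simp)

  \<comment> \<open>Bounds the quadratic term of \<open>parabola\<close>, with vertex
    \<open>x\<close> and \<open>\<sigma> = 1\<close>, over the unit cube, which represents the whole
    torus.\<close>
  define b where "b = (L / (2 * \<nu>) + G\<^sup>2 / 4) * (norm (1 :: real ^ 'n) + norm x)\<^sup>2"
  define M where "M = \<bar>g x\<bar> + 1 + b + \<bar>m\<bar>"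
  have b: "0 \<le> b" using L \<nu> by (simp add: b_def)
  have bdd: "\<bar>u y t\<bar> \<le> M" if t: "0 \<le> t" for y t
  proof -
    obtain y' where y': "torus_eq y' y" "y' \<in> cbox 0 1" by (rule torus_eq_cbox)
    have "u y t = u y' t" using per[OF t] y'(1) unfolding periodic_def by metis
    also have "\<dots> \<le> g x + 1 + (L / (2 * \<nu>) + G\<^sup>2 / 4) * (norm (y' - x))\<^sup>2"
      using parabola[OF x _ t, of 1 y'] by simp
    also have "\<dots> \<le> g x + 1 + b"
    proof -
      have "norm y' \<le> norm (1 :: real ^ 'n)"
        using y'(2) by (intro norm_le_componentwise_cart) (auto simp: mem_box_cart)
      then have "norm (y' - x) \<le> norm (1 :: real ^ 'n) + norm x"
        using norm_triangle_ineq4[of y' x] by linarith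
      then have "(L / (2 * \<nu>) + G\<^sup>2 / 4) * (norm (y' - x))\<^sup>2 \<le> b"
        unfolding b_def using L \<nu> by (intro mult_left_mono power_mono) auto
      then show ?thesis by simp
    qed
    finally show ?thesis using u_ge[OF t, of y] b unfolding M_def by linarith
  qed

  \<comment> \<open>Encodes that the upper limit of \<open>u y\<close> at infinity is at most
    \<open>c\<close>.\<close>
  define limit_le where "limit_le y c \<longleftrightarrow> (\<forall>\<eta>>0. eventually (\<lambda>t. u y t \<le> c + \<eta>) at_top)" for y c
  have limit_cong: "limit_le y c \<longleftrightarrow> limit_le y' c" if "torus_eq y y'" for y y' c
  proof -
    have "eventually (\<lambda>t. u y t = u y' t) at_top"
      by (rule eventually_mono[OF eventually_ge_at_top[of 0]])
         (use per that in \<open>auto simp: periodic_def\<close>)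
    then have "eventually (\<lambda>t. u y t \<le> d) at_top \<longleftrightarrow> eventually (\<lambda>t. u y' t \<le> d) at_top" for d
      by (rule eventually_cong) simp
    then show ?thesis by (simp add: limit_le_def)
  qed
  have limit_mono: "limit_le y c'" if "limit_le y c" "c \<le> c'" for y c c'
    unfolding limit_le_def
  proof (intro allI impI)
    fix \<eta> :: real assume "0 < \<eta>"
    with that(1) have "eventually (\<lambda>t. u y t \<le> c + \<eta>) at_top" by (simp add: limit_le_def)
    then show "eventually (\<lambda>t. u y t \<le> c' + \<eta>) at_top"
      by eventually_elim (use that(2) in linarith)
  qed
  have step: "limit_le y' (c + (f y * norm (y' - y) + L / 2 * (norm (y' - y))\<^sup>2) / \<nu>)"
    if "limit_le y c" for y y' c
    unfolding limit_le_def
    using that[unfolded limit_le_def] f(1)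
    by (intro allI impI subsolution_propagation[OF alpha sub per cont bdd H_ge \<nu>(1) L(1)]) auto

  have f_nbhd: "f y \<le> L * \<epsilon>" if y: "y \<in> torus_nbhd Z \<epsilon>" for y \<epsilon>
  proof -
    obtain z where z: "z \<in> Z" "torus_dist y z < \<epsilon>" using torus_nbhd_less[OF y] x by blast
    then have "f y \<le> L * torus_dist y z" using L(2)[of y z] f_Z by (simp add: abs_le_iff)
    also have "\<dots> \<le> L * \<epsilon>" using z L by simp
    finally show ?thesis .
  qed

  obtain \<epsilon>\<^sub>0 where \<epsilon>\<^sub>0: "0 < \<epsilon>\<^sub>0" and chain': "\<And>\<epsilon> x. 0 < \<epsilon> \<Longrightarrow> \<epsilon> < \<epsilon>\<^sub>0 \<Longrightarrow> x \<in> torus_nbhd Z \<epsilon> \<Longrightarrow>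
      \<exists>x\<^sub>0\<in>Z \<inter> argmin_set g. \<exists>n xs \<gamma>.
         is_polygonal_line n xs \<gamma> \<and> \<gamma> \<subseteq> torus_nbhd Z \<epsilon> \<and>
         xs 0 = x\<^sub>0 \<and> xs n = x \<and>
         (\<forall>i\<in>{1..n}. torus_dist (xs (i - 1)) (xs i) = \<epsilon>) \<and>
         real n \<le> C * \<epsilon> powr (- D)"
    using chain by metis
  have limit_\<epsilon>: "limit_le x (m + C * (3 / 2 * L / \<nu>) * \<epsilon> powr (2 - D))" if \<epsilon>: "0 < \<epsilon>" "\<epsilon> < \<epsilon>\<^sub>0" for \<epsilon>
  proof -
    obtain n xs \<gamma> where line: "is_polygonal_line n xs \<gamma>" and \<gamma>: "\<gamma> \<subseteq> torus_nbhd Z \<epsilon>"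
      and ends: "xs 0 \<in> Z \<inter> argmin_set g" "xs n = x"
      and len: "\<And>i. i \<in> {1..n} \<Longrightarrow> torus_dist (xs (i - 1)) (xs i) = \<epsilon>"
      and n: "real n \<le> C * \<epsilon> powr (- D)"
      using chain'[OF \<epsilon> mem_torus_nbhd[OF x \<epsilon>(1)]] by blast
    obtain S where S: "\<And>i. i \<in> {1..n} \<Longrightarrow> is_torus_segment (xs (i - 1)) (xs i) (S i)"
      and \<gamma>_eq: "\<gamma> = (\<Union>i\<in>{1..n}. S i)"
      using line unfolding is_polygonal_line_def by blast
    have "i \<le> n \<Longrightarrow> limit_le (xs i) (m + real i * (3 / 2 * L * \<epsilon>\<^sup>2 / \<nu>))" for i
    proof (induction i)
      \<comment> \<open>The chain starts at a point of \<open>Z\<close> that minimises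
        \<open>g\<close>, where \<open>u_Z\<close> bounds \<open>u\<close> by \<open>m\<close> at
        all times.\<close>
      case 0
      have "g (xs 0) = m" using ends(1) by (simp add: argmin_set_def m_def)
      then have "u (xs 0) t \<le> m" if "0 \<le> t" for t
        using u_Z[OF _ that, of "xs 0"] ends(1) by simp
      then show ?case
        unfolding limit_le_def
        by (auto intro!: eventually_at_top_linorderI[of 0] add_increasing2)
    next
      case (Suc i)
      then have i: "Suc i \<in> {1..n}" by simp
      \<comment> \<open>Each edge is lifted separately to a Euclidean segment. The lifts need not
        match at the joints, as \<open>limit_le\<close> is invariant under a change of
        representative.\<close>
      obtain a b where ab: "torus_eq a (xs i)" "torus_eq b (xs (Suc i))"
        "dist a b = torus_dist (xs i) (xs (Suc i))"
        "S (Suc i) = {z. \<exists>w\<in>closed_segment a b. torus_eq z w}"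
        using S[OF i] unfolding is_torus_segment_def by auto
      have "dist a b = \<epsilon>" using ab(3) len[OF i] by simp
      then have ba: "norm (b - a) = \<epsilon>" by (simp add: dist_norm norm_minus_commute)
      \<comment> \<open>The vertex of the cone lies on the chain, hence in the
        \<epsilon>-neighbourhood of \<open>Z\<close>, where \<open>f\<close> is at most
        \<open>L * \<epsilon>\<close>.\<close>
      have "a \<in> S (Suc i)" unfolding ab(4) by (auto intro!: bexI[of _ a])
      then have "f a \<le> L * \<epsilon>" using \<gamma> \<gamma>_eq i by (intro f_nbhd) blast
      then have "f a * \<epsilon> \<le> L * \<epsilon> * \<epsilon>" using \<epsilon> by (intro mult_right_mono) auto
      then have "(f a * \<epsilon> + L / 2 * \<epsilon>\<^sup>2) / \<nu> \<le> 3 / 2 * L * \<epsilon>\<^sup>2 / \<nu>"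
        using \<nu>(1) by (intro divide_right_mono) (auto simp: power2_eq_square mult_ac)
      moreover have b: "limit_le b (m + real i * (3 / 2 * L * \<epsilon>\<^sup>2 / \<nu>) + (f a * \<epsilon> + L / 2 * \<epsilon>\<^sup>2) / \<nu>)"
        using step[of a _ b] Suc limit_cong[OF ab(1)] ba by simp
      moreover have "m + real (Suc i) * (3 / 2 * L * \<epsilon>\<^sup>2 / \<nu>)
          = m + real i * (3 / 2 * L * \<epsilon>\<^sup>2 / \<nu>) + 3 / 2 * L * \<epsilon>\<^sup>2 / \<nu>"
        by (simp add: distrib_right add_divide_distrib)
      ultimately have "limit_le b (m + real (Suc i) * (3 / 2 * L * \<epsilon>\<^sup>2 / \<nu>))"
        by (intro limit_mono[OF b]) linarith
      then show ?case using limit_cong[OF ab(2)] by simp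
    qed
    then have "limit_le x (m + real n * (3 / 2 * L * \<epsilon>\<^sup>2 / \<nu>))" using ends(2) by blast
    moreover have "real n * (3 / 2 * L * \<epsilon>\<^sup>2 / \<nu>) \<le> C * (3 / 2 * L / \<nu>) * \<epsilon> powr (2 - D)"
    proof -
      have "real n * (3 / 2 * L * \<epsilon>\<^sup>2 / \<nu>) \<le> C * \<epsilon> powr (- D) * (3 / 2 * L * \<epsilon>\<^sup>2 / \<nu>)"
        using n L \<nu> by (intro mult_right_mono) auto
      also have "\<epsilon> powr (2 - D) = \<epsilon>\<^sup>2 * \<epsilon> powr (- D)"
        using \<epsilon> by (simp add: powr_diff powr_minus divide_inverse)
      then have "C * \<epsilon> powr (- D) * (3 / 2 * L * \<epsilon>\<^sup>2 / \<nu>) = C * (3 / 2 * L / \<nu>) * \<epsilon> powr (2 - D)"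
        by simp
      finally show ?thesis .
    qed
    ultimately show ?thesis using limit_mono by simp
  qed
  have "limit_le x m"
    unfolding limit_le_def
  proof (intro allI impI)
    fix \<eta> :: real assume \<eta>: "0 < \<eta>"
    \<comment> \<open>The bound on \<open>D\<close> makes the exponent \<open>2 - D\<close>
      positive, and \<open>0 powr (2 - D)\<close> is \<open>0\<close>, so the total cost of the
      chain vanishes in the limit.\<close>
    have "((\<lambda>\<epsilon>. C * (3 / 2 * L / \<nu>) * \<epsilon> powr (2 - D)) \<longlongrightarrow> C * (3 / 2 * L / \<nu>) * 0 powr (2 - D)) (at_right 0)"
      using D by (intro tendsto_intros tendsto_powr') (auto intro: eventually_mono[OF eventually_at_right_less])
    then have "eventually (\<lambda>\<epsilon>. C * (3 / 2 * L / \<nu>) * \<epsilon> powr (2 - D) < \<eta> / 2) (at_right 0)"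
      using \<eta> by (intro order_tendstoD(2)) auto
    moreover have "eventually (\<lambda>\<epsilon>. \<epsilon> \<in> {0<..<\<epsilon>\<^sub>0}) (at_right 0)"
      using \<epsilon>\<^sub>0 by (rule eventually_at_right_real)
    ultimately have "eventually (\<lambda>\<epsilon>. C * (3 / 2 * L / \<nu>) * \<epsilon> powr (2 - D) < \<eta> / 2 \<and> \<epsilon> \<in> {0<..<\<epsilon>\<^sub>0}) (at_right 0)"
      by (rule eventually_conj)
    then obtain \<epsilon> where \<epsilon>: "C * (3 / 2 * L / \<nu>) * \<epsilon> powr (2 - D) < \<eta> / 2" "0 < \<epsilon>" "\<epsilon> < \<epsilon>\<^sub>0"
      using eventually_happens'[OF trivial_limit_at_right_real] by auto
    have "eventually (\<lambda>t. u x t \<le> m + C * (3 / 2 * L / \<nu>) * \<epsilon> powr (2 - D) + \<eta> / 2) at_top"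
      using limit_\<epsilon>[OF \<epsilon>(2,3)] \<eta> unfolding limit_le_def by simp
    then show "eventually (\<lambda>t. u x t \<le> m + \<eta>) at_top"
      by eventually_elim (use \<epsilon>(1) in linarith)
  qed
  show "((\<lambda>t. u x t) \<longlongrightarrow> torus_min g) at_top"
    unfolding m_def[symmetric]
  proof (rule order_tendstoI)
    fix l assume "l < m"
    then show "eventually (\<lambda>t. l < u x t) at_top"
      using u_ge by (intro eventually_at_top_linorderI[of 0]) (auto intro: less_le_trans)
  next
    fix l assume "m < l"
    then have "eventually (\<lambda>t. u x t \<le> m + (l - m) / 2) at_top"
      using \<open>limit_le x m\<close> unfolding limit_le_def by simp
    then show "eventually (\<lambda>t. u x t < l) at_top"
      by eventually_elim (use \<open>m < l\<close> in \<open>simp add: field_simps\<close>)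
  qed
qed

end
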